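(* Let $H$ be a Hilbert space, let $k\geq 1$ be a natural number with $k<\dim H$, and fix an orthonormal basis of $H$. Let $\phi\colon B(H)\to B(H)$ be a positive unital linear map which maps the set of projections of rank $k$ in $B(H)$ onto itself, i.e. $\{\phi(P) : P\in B(H) \text{ a projection of rank } k\}$ is equal to the set of all projections of rank $k$ in $B(H)$. Then there exists a unitary operator $U$ on $H$ such that either $\phi(a)=UaU^*$ for all $a\in B(H)$, or $\phi(a)=Ua^tU^*$ for all $a\in B(H)$, where $a^t$ denotes the transpose of $a$ with respect to the fixed orthonormal basis.
   Context: $H$ is a complex Hilbert space of arbitrary (finite or infinite) dimension, and $B(H)$ is the algebra of bounded linear operators on $H$. A projection is a self-adjoint idempotent operator ($P=P^*=P^2$), and its rank is the dimension of its range. A linear map $\phi\colon B(H)\to B(H)$ is positive if it maps positive operators to positive operators, and unital if $\phi(1)=1$. The transpose $a^t$ of $a\in B(H)$ with respect to an orthonormal basis $(e_i)$ of $H$ is the bounded operator determined by $(a^t e_j,e_i)=(a e_i,e_j)$ for all $i,j$. *)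

theory Defs
  imports "HOL-Analysis.Analysis" "HOL-Library.Extended_Nat"
begin

class complex_vector = real_vector +
  fixes scaleC :: "complex \<Rightarrow> 'a \<Rightarrow> 'a"  (infixr "*\<^sub>C" 75)
  assumes scaleC_add_right: "c *\<^sub>C (x + y) = c *\<^sub>C x + c *\<^sub>C y"
    and scaleC_add_left: "(c + d) *\<^sub>C x = c *\<^sub>C x + d *\<^sub>C x"
    and scaleC_scaleC: "c *\<^sub>C (d *\<^sub>C x) = (c * d) *\<^sub>C x"
    and scaleC_one: "1 *\<^sub>C x = x"
    and scaleR_scaleC: "r *\<^sub>R x = complex_of_real r *\<^sub>C x"

global_interpretation complex_vector:
  vector_space "scaleC :: complex \<Rightarrow> 'a \<Rightarrow> 'a::complex_vector"
  defines cspan = complex_vector.span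
    and cdim = complex_vector.dim
  by unfold_locales
    (fact scaleC_add_right scaleC_add_left scaleC_scaleC scaleC_one)+

definition clinear :: "('a::complex_vector \<Rightarrow> 'b::complex_vector) \<Rightarrow> bool" where
  "clinear f \<longleftrightarrow> Vector_Spaces.linear scaleC scaleC f"

text \<open>The library dimension of an infinite-dimensional space is 0; the following
  extended dimension is infinite in that case. It is meant for subspaces.\<close>

definition ecdim :: "'a::complex_vector set \<Rightarrow> enat" where
  "ecdim S = (if \<exists>B. finite B \<and> S \<subseteq> cspan B then enat (cdim S) else \<infinity>)"

text \<open>The inner product is linear in its first argument. The norm axioms of
  \<^class>\<open>real_normed_vector\<close> are consequences of the others; they are included so
  that the norm topology of the library is available.\<close>

class complex_inner = complex_vector + real_normed_vector +
  fixes cinner :: "'a \<Rightarrow> 'a \<Rightarrow> complex"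
  assumes cinner_commute: "cinner x y = cnj (cinner y x)"
    and cinner_add_left: "cinner (x + y) z = cinner x z + cinner y z"
    and cinner_scaleC_left: "cinner (c *\<^sub>C x) y = c * cinner x y"
    and cinner_ge_zero: "0 \<le> Re (cinner x x)"
    and cinner_eq_zero_iff: "cinner x x = 0 \<longleftrightarrow> x = 0"
    and norm_eq_sqrt_cinner: "norm x = sqrt (Re (cinner x x))"

class chilbert_space = complex_inner + complete_space

definition orthonormal_basis :: "('i \<Rightarrow> 'a::complex_inner) \<Rightarrow> bool" where
  "orthonormal_basis e \<longleftrightarrow>
     (\<forall>i j. cinner (e i) (e j) = (if i = j then 1 else 0)) \<and>
     closure (cspan (range e)) = UNIV"

typedef (overloaded) 'a bop =
  "{f :: 'a::complex_inner \<Rightarrow> 'a. clinear f \<and> (\<exists>K. \<forall>x. norm (f x) \<le> K * norm x)}"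
  morphisms bop_apply Bop
proof -
  have "clinear (\<lambda>x::'a. x)"
    unfolding clinear_def by (rule complex_vector.linear_ident)
  moreover have "\<forall>x::'a. norm x \<le> 1 * norm x" by simp
  ultimately show ?thesis by blast
qed

setup_lifting type_definition_bop

lemma clinear_iff:
  "clinear f \<longleftrightarrow> (\<forall>x y. f (x + y) = f x + f y) \<and> (\<forall>c x. f (c *\<^sub>C x) = c *\<^sub>C f x)"
  unfolding clinear_def Vector_Spaces.linear_iff
  by (simp add: complex_vector.vector_space_axioms)

lemma norm_scaleC: "norm (c *\<^sub>C x) = cmod c * norm (x::'a::complex_inner)"
proof -
  have "cinner (c *\<^sub>C x) (c *\<^sub>C x) = (c * cnj c) * cinner x x"
    by (metis cinner_commute cinner_scaleC_left complex_cnj_mult mult.assoc)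
  then have "Re (cinner (c *\<^sub>C x) (c *\<^sub>C x)) = (cmod c)\<^sup>2 * Re (cinner x x)"
    by (simp add: complex_mult_cnj cmod_power2)
  then show ?thesis
    by (simp add: norm_eq_sqrt_cinner real_sqrt_mult)
qed

instantiation bop :: (complex_inner) complex_vector
begin

lift_definition zero_bop :: "'a bop" is "\<lambda>_. 0"
  by (auto simp: clinear_iff complex_vector.scale_zero_right intro: exI[of _ 0])

lift_definition plus_bop :: "'a bop \<Rightarrow> 'a bop \<Rightarrow> 'a bop" is "\<lambda>f g x. f x + g x"
proof -
  fix f g :: "'a \<Rightarrow> 'a"
  assume f: "clinear f \<and> (\<exists>K. \<forall>x. norm (f x) \<le> K * norm x)"
    and g: "clinear g \<and> (\<exists>K. \<forall>x. norm (g x) \<le> K * norm x)"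
  obtain K L where K: "\<And>x. norm (f x) \<le> K * norm x" and L: "\<And>x. norm (g x) \<le> L * norm x"
    using f g by blast
  have "norm (f x + g x) \<le> (K + L) * norm x" for x
    using norm_triangle_mono[OF K L] by (simp add: distrib_right)
  then show "clinear (\<lambda>x. f x + g x) \<and> (\<exists>K. \<forall>x. norm (f x + g x) \<le> K * norm x)"
    using f g by (auto simp: clinear_iff scaleC_add_right)
qed

lift_definition scaleC_bop :: "complex \<Rightarrow> 'a bop \<Rightarrow> 'a bop" is "\<lambda>c f x. c *\<^sub>C f x"
proof -
  fix c :: complex and f :: "'a \<Rightarrow> 'a"
  assume f: "clinear f \<and> (\<exists>K. \<forall>x. norm (f x) \<le> K * norm x)"
  obtain K where K: "\<And>x. norm (f x) \<le> K * norm x"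
    using f by blast
  have "norm (c *\<^sub>C f x) \<le> (cmod c * K) * norm x" for x
    using mult_left_mono[OF K, of "cmod c"] by (simp add: norm_scaleC mult.assoc)
  then have "\<exists>K. \<forall>x. norm (c *\<^sub>C f x) \<le> K * norm x" by blast
  moreover have "clinear (\<lambda>x. c *\<^sub>C f x)"
    using f by (simp add: clinear_iff scaleC_add_right scaleC_scaleC mult.commute)
  ultimately show "clinear (\<lambda>x. c *\<^sub>C f x) \<and> (\<exists>K. \<forall>x. norm (c *\<^sub>C f x) \<le> K * norm x)"
    by blast
qed

definition scaleR_bop :: "real \<Rightarrow> 'a bop \<Rightarrow> 'a bop" where
  "scaleR_bop r a = complex_of_real r *\<^sub>C a"

definition uminus_bop :: "'a bop \<Rightarrow> 'a bop" where
  "uminus_bop a = (-1) *\<^sub>C a"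

definition minus_bop :: "'a bop \<Rightarrow> 'a bop \<Rightarrow> 'a bop" where
  "minus_bop a b = a + (-1) *\<^sub>C b"

instance
proof
  fix a b c :: "'a bop" and r s :: real and u v :: complex
  show "a + b + c = a + (b + c)" by transfer (simp add: add.assoc)
  show "a + b = b + a" by transfer (simp add: add.commute)
  show "0 + a = a" by transfer simp
  show "- a + a = 0"
    unfolding uminus_bop_def
    by transfer (simp add: complex_vector.scale_minus_left scaleC_one)
  show "a - b = a + - b" unfolding minus_bop_def uminus_bop_def ..
  show add_right: "u *\<^sub>C (a + b) = u *\<^sub>C a + u *\<^sub>C b" for u :: complex and a b :: "'a bop"
    by transfer (simp add: scaleC_add_right)
  show add_left: "(u + v) *\<^sub>C a = u *\<^sub>C a + v *\<^sub>C a" for u v :: complex and a :: "'a bop"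
    by transfer (simp add: scaleC_add_left)
  show scale: "u *\<^sub>C (v *\<^sub>C a) = (u * v) *\<^sub>C a" for u v :: complex and a :: "'a bop"
    by transfer (simp add: scaleC_scaleC)
  show one: "1 *\<^sub>C a = a" for a :: "'a bop"
    by transfer (simp add: scaleC_one)
  show "r *\<^sub>R (a + b) = r *\<^sub>R a + r *\<^sub>R b" by (simp add: scaleR_bop_def add_right)
  show "(r + s) *\<^sub>R a = r *\<^sub>R a + s *\<^sub>R a" by (simp add: scaleR_bop_def add_left)
  show "r *\<^sub>R (s *\<^sub>R a) = (r * s) *\<^sub>R a" by (simp add: scaleR_bop_def scale)
  show "1 *\<^sub>R a = a" by (simp add: scaleR_bop_def one)
  show "r *\<^sub>R a = complex_of_real r *\<^sub>C a" by (rule scaleR_bop_def)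
qed

end

instantiation bop :: (complex_inner) "{ring, monoid_mult}"
begin

lift_definition one_bop :: "'a bop" is "\<lambda>x. x"
  by (auto simp: clinear_iff intro: exI[of _ 1])

lift_definition times_bop :: "'a bop \<Rightarrow> 'a bop \<Rightarrow> 'a bop" is "\<lambda>f g x. f (g x)"
proof -
  fix f g :: "'a \<Rightarrow> 'a"
  assume f: "clinear f \<and> (\<exists>K. \<forall>x. norm (f x) \<le> K * norm x)"
    and g: "clinear g \<and> (\<exists>K. \<forall>x. norm (g x) \<le> K * norm x)"
  obtain K L where K: "\<And>x. norm (f x) \<le> K * norm x" and L: "\<And>x. norm (g x) \<le> L * norm x"
    using f g by blast
  have "norm (f (g x)) \<le> (\<bar>K\<bar> * L) * norm x" for x
  proof -
    have "norm (f (g x)) \<le> \<bar>K\<bar> * norm (g x)"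
      using K[of "g x"] by (meson abs_ge_self mult_right_mono norm_ge_zero order_trans)
    also have "\<dots> \<le> \<bar>K\<bar> * (L * norm x)"
      by (rule mult_left_mono[OF L]) simp
    finally show ?thesis by (simp add: mult.assoc)
  qed
  then show "clinear (\<lambda>x. f (g x)) \<and> (\<exists>K. \<forall>x. norm (f (g x)) \<le> K * norm x)"
    using f g by (auto simp: clinear_iff)
qed

instance
proof
  fix a b c :: "'a bop"
  show "a * b * c = a * (b * c)" by transfer simp
  show "(a + b) * c = a * c + b * c" by transfer simp
  show "a * (b + c) = a * b + a * c" by transfer (simp add: clinear_iff)
  show "1 * a = a" by transfer simp
  show "a * 1 = a" by transfer simp
qed

end

text \<open>The two definite descriptions below are well defined: the adjoint exists on every
  Hilbert space by Riesz representation, and the transpose with respect to an orthonormal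
  basis is the adjoint conjugated by the antiunitary involution fixing the basis.\<close>

definition op_adjoint :: "'a::chilbert_space bop \<Rightarrow> 'a bop" where
  "op_adjoint a = (THE b. \<forall>x y. cinner (bop_apply a x) y = cinner x (bop_apply b y))"

definition op_transpose :: "('i \<Rightarrow> 'a::chilbert_space) \<Rightarrow> 'a bop \<Rightarrow> 'a bop" where
  "op_transpose e a = (THE b. \<forall>i j.
     cinner (bop_apply b (e j)) (e i) = cinner (bop_apply a (e i)) (e j))"

definition is_projection :: "'a::chilbert_space bop \<Rightarrow> bool" where
  "is_projection P \<longleftrightarrow> op_adjoint P = P \<and> P * P = P"

definition op_rank :: "'a::complex_inner bop \<Rightarrow> enat" where
  "op_rank a = ecdim (range (bop_apply a))"

definition unitary_op :: "'a::chilbert_space bop \<Rightarrow> bool" where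
  "unitary_op U \<longleftrightarrow> op_adjoint U * U = 1 \<and> U * op_adjoint U = 1"

definition positive_op :: "'a::complex_inner bop \<Rightarrow> bool" where
  "positive_op a \<longleftrightarrow>
     (\<forall>x. Im (cinner (bop_apply a x) x) = 0 \<and> 0 \<le> Re (cinner (bop_apply a x) x))"

definition positive_map ::
    "('a::complex_inner bop \<Rightarrow> 'b::complex_inner bop) \<Rightarrow> bool" where
  "positive_map \<phi> \<longleftrightarrow> (\<forall>a. positive_op a \<longrightarrow> positive_op (\<phi> a))"

definition rank_projections :: "nat \<Rightarrow> 'a::chilbert_space bop set" where
  "rank_projections k = {P. is_projection P \<and> op_rank P = enat k}"

end

theory Submission
  imports Defs
begin

text \<open>If \<open>b\<close> runs over \<open>k + 1\<close> orthonormal vectors, the images of the projections omitting one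
  vector force the images of the \<open>outer b b\<close> to be mutually orthogonal projections, and counting
  ranks shows that each has rank one. So \<open>\<phi>\<close> maps rank one projections to rank one projections and
  preserves orthogonality.

  Fix a unit vector \<open>e\<close> with \<open>\<phi> (outer e e) = outer f f\<close>. The operators \<open>\<phi> (outer u u)\<close> with
  \<open>u = z + c e\<close> and \<open>z\<close> orthogonal to \<open>e\<close> have rank one, hence are determined by their values
  \<open>\<bar>c\<bar>\<^sup>2 f + cnj c T z + c S z\<close> at \<open>f\<close>, where \<open>T z = \<phi> (outer z e) f\<close> is linear and
  \<open>S z = \<phi> (outer e z) f\<close> is antilinear in \<open>z\<close>. Comparing Fourier coefficients for \<open>\<bar>c\<bar> = 1\<close> gives
  \<open>outer (S z) (T z) = 0\<close>, so one of \<open>S\<close>, \<open>T\<close> vanishes on the complement of \<open>e\<close>, and the other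
  one implements \<open>\<phi>\<close> on rank one operators. It is onto because \<open>\<phi>\<close> is onto the rank \<open>k\<close>
  projections. The extension from rank one operators to all operators uses positivity.\<close>

section \<open>Inner products and Riesz representation\<close>

lemma cinner_add_right: "cinner x (y + z) = cinner x y + cinner x (z::'a::complex_inner)"
  by (metis cinner_add_left cinner_commute complex_cnj_add)

lemma cinner_scaleC_right: "cinner x (c *\<^sub>C y) = cnj c * cinner x (y::'a::complex_inner)"
  by (metis cinner_commute cinner_scaleC_left complex_cnj_mult)

lemma cinner_zero_left [simp]: "cinner 0 (y::'a::complex_inner) = 0"
  using cinner_add_left[of 0 0 y] by simp

lemma cinner_zero_right [simp]: "cinner (y::'a::complex_inner) 0 = 0"
  using cinner_add_right[of y 0 0] by simp

lemma cinner_minus_left: "cinner (- x) (y::'a::complex_inner) = - cinner x y"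
  using cinner_add_left[of x "- x" y] by (simp add: eq_neg_iff_add_eq_0 add.commute)

lemma cinner_minus_right: "cinner x (- y) = - cinner x (y::'a::complex_inner)"
  using cinner_add_right[of x y "- y"] by (simp add: eq_neg_iff_add_eq_0 add.commute)

lemma cinner_diff_left: "cinner (x - y) z = cinner x z - cinner y (z::'a::complex_inner)"
  using cinner_add_left[of x "- y" z] by (simp add: cinner_minus_left)

lemma cinner_diff_right: "cinner z (x - y) = cinner z x - cinner z (y::'a::complex_inner)"
  using cinner_add_right[of z x "- y"] by (simp add: cinner_minus_right)

lemma cinner_sum_left: "cinner (sum f A) (y::'a::complex_inner) = (\<Sum>a\<in>A. cinner (f a) y)"
  by (induction A rule: infinite_finite_induct) (simp_all add: cinner_add_left)

lemma cinner_sum_right: "cinner (y::'a::complex_inner) (sum f A) = (\<Sum>a\<in>A. cinner y (f a))"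
  by (induction A rule: infinite_finite_induct) (simp_all add: cinner_add_right)

lemma scaleC_zero_left [simp]: "0 *\<^sub>C (x::'a::complex_vector) = 0"
  and scaleC_zero_right [simp]: "c *\<^sub>C (0::'a::complex_vector) = 0"
  and scaleC_one' [simp]: "1 *\<^sub>C (x::'a::complex_vector) = x"
  and scaleC_minus1: "(-1) *\<^sub>C (x::'a::complex_vector) = - x"
  and scaleC_minus_left: "(- c) *\<^sub>C x = - (c *\<^sub>C (x::'a::complex_vector))"
  by (simp_all add: scaleC_one)

lemma cinner_self: "cinner x x = complex_of_real ((norm (x::'a::complex_inner))\<^sup>2)"
proof -
  have "Im (cinner x x) = 0"
    using arg_cong[OF cinner_commute[of x x], of Im] by simp
  then show ?thesis
    by (simp add: complex_eq_iff norm_eq_sqrt_cinner cinner_ge_zero)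
qed

lemmas cinner_lin = cinner_add_left cinner_add_right cinner_scaleC_left cinner_scaleC_right
  cinner_diff_left cinner_diff_right cinner_minus_left cinner_minus_right

text \<open>Nonnegativity at \<open>x + c *\<^sub>C y\<close> bounds a quadratic polynomial in a
  real parameter. Semidefinite forms are allowed, so the inequality serves both
  \<open>cinner\<close> and the form of a positive operator.\<close>

lemma psd_form_Cauchy_Schwarz:
  fixes B :: "'a::complex_vector \<Rightarrow> 'a \<Rightarrow> complex"
  assumes add: "\<And>x y z. B (x + y) z = B x z + B y z"
    and scale: "\<And>c x y. B (c *\<^sub>C x) y = c * B x y"
    and herm: "\<And>x y. B x y = cnj (B y x)"
    and pos: "\<And>x. 0 \<le> Re (B x x)"
  shows "(cmod (B x y))\<^sup>2 \<le> Re (B x x) * Re (B y y)"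
proof -
  have add': "B x (y + z) = B x y + B x z" for x y z
    by (metis add herm complex_cnj_add)
  have scale': "B x (c *\<^sub>C y) = cnj c * B x y" for c x y
    by (metis scale herm complex_cnj_mult)
  define b p q where "b = B x y" and "p = Re (B x x)" and "q = Re (B y y)"
  have byx: "B y x = cnj b" unfolding b_def by (rule herm)
  have key: "0 \<le> p - 2 * s * (cmod b)\<^sup>2 + s\<^sup>2 * (cmod b)\<^sup>2 * q" for s :: real
  proof -
    \<comment> \<open>This phase of \<open>c\<close> makes both cross terms real, with sum -2 s
      |b|^2.\<close>
    define c where "c = - complex_of_real s * b"
    have Bc: "B (x + c *\<^sub>C y) (x + c *\<^sub>C y)
        = B x x + cnj c * b + c * cnj b + (c * cnj c) * B y y"
      by (simp add: add add' scale scale' byx b_def algebra_simps)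
    have "Re (cnj c * b + c * cnj b) = - 2 * s * (cmod b)\<^sup>2"
      by (simp add: c_def cmod_power2) (simp add: power2_eq_square algebra_simps)
    moreover have "c * cnj c = complex_of_real (s\<^sup>2 * (cmod b)\<^sup>2)"
      by (simp add: c_def complex_mult_cnj cmod_power2 complex_eq_iff)
        (simp add: power2_eq_square algebra_simps)
    ultimately have "Re (B (x + c *\<^sub>C y) (x + c *\<^sub>C y)) = p - 2 * s * (cmod b)\<^sup>2 + s\<^sup>2 * (cmod b)\<^sup>2 * q"
      unfolding Bc p_def q_def by simp
    then show ?thesis using pos by metis
  qed
  have p0: "0 \<le> p" and q0: "0 \<le> q" unfolding p_def q_def by (rule pos)+
  show ?thesis
  proof (cases "q = 0")
    case True
    have "(cmod b)\<^sup>2 \<le> 0"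
    proof (rule ccontr)
      assume "\<not> (cmod b)\<^sup>2 \<le> 0"
      then have "(cmod b)\<^sup>2 > 0" by simp
      \<comment> \<open>For \<open>q = 0\<close> the bound is affine in s, and this s gives it the
        value -1.\<close>
      with key[of "(p + 1) / (2 * (cmod b)\<^sup>2)"] True show False
        by (simp add: field_simps)
    qed
    then show ?thesis using True by (simp add: b_def q_def)
  next
    case False
    then have "q > 0" using q0 by simp
    \<comment> \<open>The quadratic polynomial in s attains its minimum at 1 / q.\<close>
    with key[of "1 / q"] show ?thesis
      unfolding b_def[symmetric] p_def[symmetric] q_def[symmetric]
      by (simp add: field_simps power2_eq_square)
  qed
qed

lemma cinner_Cauchy_Schwarz: "cmod (cinner x y) \<le> norm x * norm (y::'a::complex_inner)"
proof -
  have "(cmod (cinner x y))\<^sup>2 \<le> Re (cinner x x) * Re (cinner y y)"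
    by (rule psd_form_Cauchy_Schwarz)
      (auto simp: cinner_lin intro: cinner_commute cinner_ge_zero)
  also have "\<dots> = (norm x * norm y)\<^sup>2"
    by (simp add: cinner_self power_mult_distrib)
  finally show ?thesis by (rule power2_le_imp_le) simp
qed

lemma cinner_ext:
  assumes "\<And>z. cinner x z = cinner y (z::'a::complex_inner)"
  shows "x = y"
proof -
  have "cinner (x - y) (x - y) = 0" using assms by (simp add: cinner_diff_left)
  then show ?thesis by (simp add: cinner_eq_zero_iff)
qed

lemma tendsto_cinner:
  fixes f g :: "'b \<Rightarrow> 'a::complex_inner"
  assumes "(f \<longlongrightarrow> x) F" "(g \<longlongrightarrow> y) F"
  shows "((\<lambda>n. cinner (f n) (g n)) \<longlongrightarrow> cinner x y) F"
proof -
  have "bounded_bilinear (cinner :: 'a \<Rightarrow> 'a \<Rightarrow> complex)"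
    by unfold_locales
      (auto simp: cinner_lin scaleR_scaleC scaleR_conv_of_real intro!: exI[of _ 1] cinner_Cauchy_Schwarz)
  from bounded_bilinear.tendsto[OF this assms] show ?thesis .
qed

lemma norm_add_sq: "(norm (x + y))\<^sup>2 = (norm x)\<^sup>2 + (norm y)\<^sup>2 + 2 * Re (cinner x (y::'a::complex_inner))"
proof -
  have "Re (cinner (x + y) (x + y)) = Re (cinner x x) + Re (cinner y y) + 2 * Re (cinner x y)"
    using arg_cong[OF cinner_commute[of y x], of Re] by (simp add: cinner_lin)
  then show ?thesis by (simp add: cinner_self)
qed

text \<open>The representing vector minimises \<open>\<parallel>x\<parallel>\<^sup>2 - 2 Re (f x)\<close>; minimising sequences are
  Cauchy by the parallelogram identity.\<close>

lemma Riesz_representation: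
  fixes f :: "'a::chilbert_space \<Rightarrow> complex"
  assumes add: "\<And>x y. f (x + y) = f x + f y"
    and scale: "\<And>c x. f (c *\<^sub>C x) = c * f x"
    and bound: "\<And>x. cmod (f x) \<le> K * norm x"
  shows "\<exists>z. \<forall>x. f x = cinner x z"
proof -
  define g where "g x = (norm x)\<^sup>2 - 2 * Re (f x)" for x
  have lower: "- K\<^sup>2 \<le> g x" for x
  proof -
    have "Re (f x) \<le> K * norm x" using complex_Re_le_cmod bound order_trans by blast
    moreover have "0 \<le> (norm x - K)\<^sup>2" by simp
    ultimately show ?thesis by (simp add: g_def power2_eq_square algebra_simps)
  qed
  define m where "m = Inf (range g)"
  have bdd: "bdd_below (range g)" using lower by (auto intro!: bdd_belowI[of _ "- K\<^sup>2"])
  have m_le: "m \<le> g x" for x unfolding m_def by (rule cInf_lower[OF _ bdd]) simp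
  have ex: "\<exists>x. g x < m + 1 / Suc n" for n :: nat
  proof -
    have "\<exists>y\<in>range g. y < m + 1 / Suc n"
      by (rule cInf_lessD) (simp_all add: m_def[symmetric])
    then show ?thesis by auto
  qed
  then obtain X where X: "\<And>n. g (X n) < m + 1 / Suc n" by metis
  have par: "(norm (x - y))\<^sup>2 = 2 * g x + 2 * g y - 4 * g ((1/2) *\<^sub>C (x + y))" for x y
  proof -
    have a: "(norm (x - y))\<^sup>2 = (norm x)\<^sup>2 + (norm y)\<^sup>2 - 2 * Re (cinner x y)"
      using norm_add_sq[of x "- y"] by (simp add: cinner_minus_right)
    have b: "(norm ((1/2) *\<^sub>C (x + y)))\<^sup>2 = ((norm x)\<^sup>2 + (norm y)\<^sup>2 + 2 * Re (cinner x y)) / 4"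
      unfolding norm_scaleC power_mult_distrib norm_add_sq by (simp add: power2_eq_square norm_divide)
    have c: "Re (f ((1/2) *\<^sub>C (x + y))) = (Re (f x) + Re (f y)) / 2"
      by (simp add: scale add Re_divide)
    show ?thesis unfolding g_def a b c by (simp add: field_simps)
  qed
  have close: "(norm (X i - X j))\<^sup>2 < 2 / Suc i + 2 / Suc j" for i j
  proof -
    have "2 / Suc i = 2 * (1 / Suc i)" "2 / Suc j = 2 * (1 / Suc j)" by simp_all
    then show ?thesis
      using X[of i] X[of j] m_le[of "(1/2) *\<^sub>C (X i + X j)"] unfolding par by linarith
  qed
  have "Cauchy X"
  proof (rule CauchyI)
    fix r :: real assume r: "0 < r"
    then obtain N :: nat where N: "4 / r\<^sup>2 < real N" using reals_Archimedean2 by blast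
    have "norm (X i - X j) < r" if "N \<le> i" "N \<le> j" for i j
    proof -
      have "0 < real N" using N r by (smt (verit) divide_pos_pos zero_less_power)
      have "2 / Suc i \<le> 2 / real N" "2 / Suc j \<le> 2 / real N"
        using that \<open>0 < real N\<close> by (auto intro!: divide_left_mono)
      moreover have "4 / real N < r\<^sup>2" using N r \<open>0 < real N\<close> by (simp add: field_simps)
      ultimately have "(norm (X i - X j))\<^sup>2 < r\<^sup>2" using close[of i j] by linarith
      then show ?thesis using r by (simp add: power_less_imp_less_base)
    qed
    then show "\<exists>M. \<forall>i\<ge>M. \<forall>j\<ge>M. norm (X i - X j) < r" by blast
  qed
  then obtain z where z: "X \<longlonglongrightarrow> z" using Cauchy_convergent convergent_def by blast
  have "bounded_linear f"
    by (rule bounded_linear_intro[of _ K])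
      (auto simp: add scale scaleR_scaleC scaleR_conv_of_real bound mult.commute)
  then have fz: "(\<lambda>n. f (X n)) \<longlonglongrightarrow> f z" using z by (rule bounded_linear.tendsto)
  have gz: "(\<lambda>n. g (X n)) \<longlonglongrightarrow> g z"
    unfolding g_def by (intro tendsto_intros z fz)
  have "(\<lambda>n. m + 1 / Suc n) \<longlonglongrightarrow> m + 0"
    by (intro tendsto_intros LIMSEQ_Suc[OF lim_1_over_n])
  then have "g z \<le> m"
    using X by (intro LIMSEQ_le[OF gz, of _ m]) (auto intro: less_imp_le)
  then have min: "g z \<le> g x" for x using m_le order_trans by blast
  \<comment> \<open>The first variation at the minimiser \<open>z\<close> vanishes in every
    direction \<open>h\<close>; the quantity \<open>d\<close> is half the derivative.\<close>
  have re: "Re (cinner z h) = Re (f h)" for h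
  proof -
    define d where "d = Re (cinner z h) - Re (f h)"
    have 1: "0 \<le> 2 * t * d + t\<^sup>2 * (norm h)\<^sup>2" for t :: real
    proof -
      have "g (z + complex_of_real t *\<^sub>C h) = g z + (2 * t * d + t\<^sup>2 * (norm h)\<^sup>2)"
        unfolding g_def norm_add_sq d_def
        by (simp add: add scale cinner_lin norm_scaleC power_mult_distrib algebra_simps)
      then show ?thesis using min[of "z + complex_of_real t *\<^sub>C h"] by simp
    qed
    have "d = 0"
    proof (rule ccontr)
      assume "d \<noteq> 0"
      define N where "N = (norm h)\<^sup>2 + 1"
      have N: "N > 0" "N = (norm h)\<^sup>2 + 1" by (simp_all add: N_def add_nonneg_pos)
      \<comment> \<open>With N > |h|^2 the linear term outweighs the quadratic one at t = -d / N.
        Adding 1 in \<open>N\<close> also covers \<open>h = 0\<close>.\<close>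
      have "2 * (- d / N) * d + (- d / N)\<^sup>2 * (norm h)\<^sup>2 = - (d\<^sup>2 * (N + 1)) / N\<^sup>2"
        using N(1) unfolding power2_eq_square
        by (simp add: field_simps) (simp add: N(2) power2_eq_square algebra_simps)
      moreover have "d\<^sup>2 * (N + 1) / N\<^sup>2 > 0" using \<open>d \<noteq> 0\<close> N(1) by simp
      ultimately show False using 1[of "- d / N"] by simp
    qed
    then show ?thesis by (simp add: d_def)
  qed
  have "f x = cinner x z" for x
  proof -
    have c: "cinner x z = cnj (cinner z x)" by (rule cinner_commute)
    \<comment> \<open>Replacing \<open>x\<close> by i x turns the identity of real parts into one of
      imaginary parts.\<close>
    have "Re (cinner z (\<i> *\<^sub>C x)) = Re (f (\<i> *\<^sub>C x))" by (rule re)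
    then have "Im (cinner z x) = - Im (f x)" by (simp add: cinner_lin scale)
    then show ?thesis using re[of x] unfolding c by (simp add: complex_eq_iff)
  qed
  then show ?thesis by blast
qed

section \<open>Operators\<close>

lemma bop_apply_plus [simp]: "bop_apply (a + b) x = bop_apply a x + bop_apply b x"
  by transfer simp

lemma bop_apply_scaleC [simp]: "bop_apply (c *\<^sub>C a) x = c *\<^sub>C bop_apply a x"
  by transfer simp

lemma bop_apply_zero [simp]: "bop_apply 0 x = 0"
  by transfer simp

lemma bop_apply_one [simp]: "bop_apply 1 x = x"
  by transfer simp

lemma bop_apply_times [simp]: "bop_apply (a * b) x = bop_apply a (bop_apply b x)"
  by transfer simp

lemma bop_apply_minus [simp]: "bop_apply (a - b) x = bop_apply a x - bop_apply b x"
  unfolding minus_bop_def bop_apply_plus bop_apply_scaleC by (simp add: scaleC_minus1)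

lemma bop_apply_sum: "bop_apply (sum f A) x = (\<Sum>i\<in>A. bop_apply (f i) x)"
  by (induction A rule: infinite_finite_induct) simp_all

lemma bop_apply_add_right: "bop_apply a (x + y) = bop_apply a x + bop_apply a y"
  using bop_apply[of a] by (simp add: clinear_iff)

lemma bop_apply_scaleC_right: "bop_apply a (c *\<^sub>C x) = c *\<^sub>C bop_apply a x"
  using bop_apply[of a] by (simp add: clinear_iff)

lemma bop_apply_zero_right [simp]: "bop_apply a 0 = 0"
  using bop_apply_scaleC_right[of a 0 0] by simp

lemma bop_apply_minus_right: "bop_apply a (- x) = - bop_apply a x"
  using bop_apply_scaleC_right[of a "-1" x] by (simp add: scaleC_minus1)

lemma bop_apply_diff_right: "bop_apply a (x - y) = bop_apply a x - bop_apply a y"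
  using bop_apply_add_right[of a x "- y"] by (simp add: bop_apply_minus_right)

lemmas bop_lin = bop_apply_add_right bop_apply_scaleC_right bop_apply_diff_right bop_apply_minus_right

lemma bop_bound: "\<exists>K\<ge>0. \<forall>x. norm (bop_apply a x) \<le> K * norm x"
proof -
  obtain K where K: "\<And>x. norm (bop_apply a x) \<le> K * norm x"
    using bop_apply[of a] by auto
  have "norm (bop_apply a x) \<le> \<bar>K\<bar> * norm x" for x
    using K[of x] by (meson abs_ge_self mult_right_mono norm_ge_zero order_trans)
  then show ?thesis by (intro exI[of _ "\<bar>K\<bar>"]) simp
qed

lemma bop_eqI: "(\<And>x. bop_apply a x = bop_apply b x) \<Longrightarrow> a = b"
  by (metis bop_apply_inject ext)

lemma bop_apply_Bop:
  assumes "\<And>x y. f (x + y) = f x + f y" "\<And>c x. f (c *\<^sub>C x) = c *\<^sub>C f x"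
    and "\<And>x. norm (f x) \<le> K * norm x"
  shows "bop_apply (Bop f) = f"
  by (rule Bop_inverse) (use assms in \<open>auto simp: clinear_iff\<close>)

section \<open>Existence and uniqueness of adjoints\<close>

lemma ex_adjoint:
  fixes a :: "'a::chilbert_space bop"
  shows "\<exists>b. \<forall>x y. cinner (bop_apply a x) y = cinner x (bop_apply b y)"
proof -
  obtain K where K: "K \<ge> 0" "\<And>x. norm (bop_apply a x) \<le> K * norm x"
    using bop_bound by blast
  have "\<exists>z. \<forall>x. cinner (bop_apply a x) y = cinner x z" for y
  proof (rule Riesz_representation)
    show "cmod (cinner (bop_apply a x) y) \<le> (K * norm y) * norm x" for x
    proof -
      have "cmod (cinner (bop_apply a x) y) \<le> norm (bop_apply a x) * norm y"
        by (rule cinner_Cauchy_Schwarz)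
      also have "\<dots> \<le> (K * norm x) * norm y" by (intro mult_right_mono K) simp
      finally show ?thesis by (simp add: mult_ac)
    qed
  qed (simp_all add: bop_lin cinner_lin)
  then obtain f where f: "\<And>x y. cinner (bop_apply a x) y = cinner x (f y)" by metis
  have f': "cinner (f y) x = cinner y (bop_apply a x)" for x y
    by (metis f cinner_commute)
  have "bop_apply (Bop f) = f"
  proof (rule bop_apply_Bop)
    show "f (x + y) = f x + f y" for x y by (rule cinner_ext) (simp add: f' cinner_lin)
    show "f (c *\<^sub>C x) = c *\<^sub>C f x" for c x by (rule cinner_ext) (simp add: f' cinner_lin)
    show "norm (f y) \<le> K * norm y" for y
    proof (cases "f y = 0")
      case False
      \<comment> \<open>Testing the defining identity at \<open>f y\<close> itself bounds |f y|^2 by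
        K |f y| |y|; one factor |f y| then cancels.\<close>
      have "(norm (f y))\<^sup>2 = cmod (cinner (bop_apply a (f y)) y)"
        by (simp add: f cinner_self norm_power)
      also have "\<dots> \<le> norm (bop_apply a (f y)) * norm y" by (rule cinner_Cauchy_Schwarz)
      also have "\<dots> \<le> (K * norm (f y)) * norm y" by (intro mult_right_mono K) simp
      finally have "norm (f y) * norm (f y) \<le> norm (f y) * (K * norm y)"
        by (simp add: power2_eq_square mult_ac)
      then show ?thesis using False by simp
    qed (use K in simp)
  qed
  with f show ?thesis by metis
qed

text \<open>Resolves the definite description in \<open>op_adjoint\<close>: inner products against
  all vectors determine the second operator.\<close>

lemma adjoint_eqI:
  assumes "\<And>x y. cinner (bop_apply a x) y = cinner x (bop_apply b y)"
  shows "op_adjoint a = b"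
  unfolding op_adjoint_def
proof (rule the_equality)
  fix c assume "\<forall>x y. cinner (bop_apply a x) y = cinner x (bop_apply c y)"
  then have "cinner x (bop_apply c y) = cinner x (bop_apply b y)" for x y using assms by metis
  then have "cinner (bop_apply c y) x = cinner (bop_apply b y) x" for x y by (metis cinner_commute)
  then show "c = b" by (intro bop_eqI cinner_ext)
qed (use assms in simp)

lemma cinner_adjoint_right: "cinner x (bop_apply (op_adjoint a) y) = cinner (bop_apply a x) y"
  by (metis ex_adjoint adjoint_eqI)

lemma cinner_adjoint_left: "cinner (bop_apply (op_adjoint a) x) y = cinner x (bop_apply a y)"
  by (metis cinner_adjoint_right cinner_commute)

text \<open>The operator written |x><y| in bra-ket notation; for a unit vector \<open>x\<close>,
  \<open>outer x x\<close> is the projection onto the line of \<open>x\<close>.\<close>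

lift_definition outer :: "'a::complex_inner \<Rightarrow> 'a \<Rightarrow> 'a bop" is
  "\<lambda>x y v. cinner v y *\<^sub>C x"
proof -
  fix x y :: 'a
  have "norm (cinner v y *\<^sub>C x) \<le> (norm y * norm x) * norm v" for v
    using mult_right_mono[OF cinner_Cauchy_Schwarz[of v y], of "norm x"]
    by (simp add: norm_scaleC mult_ac)
  then show "clinear (\<lambda>v. cinner v y *\<^sub>C x) \<and> (\<exists>K. \<forall>v. norm (cinner v y *\<^sub>C x) \<le> K * norm v)"
    by (auto simp: clinear_iff cinner_lin scaleC_add_left scaleC_scaleC)
qed

lemma outer_apply [simp]: "bop_apply (outer x y) v = cinner v y *\<^sub>C x"
  by transfer simp

lemma outer_add_left: "outer (x + y) z = outer x z + outer y z"
  by (rule bop_eqI) (simp add: scaleC_add_right)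

lemma outer_add_right: "outer z (x + y) = outer z x + outer z y"
  by (rule bop_eqI) (simp add: cinner_lin scaleC_add_left)

lemma outer_scaleC_left: "outer (c *\<^sub>C x) z = c *\<^sub>C outer x z"
  by (rule bop_eqI) (simp add: scaleC_scaleC mult.commute)

lemma outer_scaleC_right: "outer z (c *\<^sub>C x) = cnj c *\<^sub>C outer z x"
  by (rule bop_eqI) (simp add: scaleC_scaleC cinner_lin)

lemmas outer_lin = outer_add_left outer_add_right outer_scaleC_left outer_scaleC_right

section \<open>Polarisation and positive operators\<close>

lemma quadratic_form_zero:
  assumes "\<And>x. cinner (bop_apply a x) x = 0"
  shows "a = 0"
proof (rule bop_eqI, rule cinner_ext)
  fix x y
  have 1: "cinner (bop_apply a x) y + cinner (bop_apply a y) x = 0"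
    using assms[of "x + y"] assms by (simp add: bop_lin cinner_lin add.commute)
  have "\<i> * cinner (bop_apply a y) x - \<i> * cinner (bop_apply a x) y = 0"
    using assms[of "x + \<i> *\<^sub>C y"] assms by (simp add: bop_lin cinner_lin)
  then have "cinner (bop_apply a y) x = cinner (bop_apply a x) y"
    by (simp flip: right_diff_distrib)
  with 1 show "cinner (bop_apply a x) y = cinner (bop_apply 0 x) y" by simp
qed

text \<open>Polarisation at \<open>x + y\<close> and at x + i y yields the imaginary and the real
  parts. It supplies the self-adjointness that \<open>positive_op\<close>, defined through its
  quadratic form, does not mention.\<close>

lemma real_form_symmetric:
  assumes "\<And>x. Im (cinner (bop_apply a x) x) = 0"
  shows "cinner (bop_apply a x) y = cinner x (bop_apply a y)"
proof -
  have "Im (cinner (bop_apply a x) y) + Im (cinner (bop_apply a y) x) = 0"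
    using assms[of "x + y"] assms by (simp add: bop_lin cinner_lin)
  moreover have "Re (cinner (bop_apply a y) x) = Re (cinner (bop_apply a x) y)"
    using assms[of "x + \<i> *\<^sub>C y"] assms by (simp add: bop_lin cinner_lin)
  ultimately have "cinner (bop_apply a x) y = cnj (cinner (bop_apply a y) x)"
    by (simp add: complex_eq_iff)
  then show ?thesis by (metis cinner_commute)
qed

lemma positive_op_symmetric:
  "positive_op a \<Longrightarrow> cinner (bop_apply a x) y = cinner x (bop_apply a y)"
  by (rule real_form_symmetric) (simp add: positive_op_def)

lemma positive_op_Cauchy_Schwarz:
  assumes "positive_op a"
  shows "(cmod (cinner (bop_apply a x) y))\<^sup>2
    \<le> Re (cinner (bop_apply a x) x) * Re (cinner (bop_apply a y) y)"
proof (rule psd_form_Cauchy_Schwarz)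
  show "cinner (bop_apply a x) y = cnj (cinner (bop_apply a y) x)" for x y
    by (metis assms positive_op_symmetric cinner_commute)
qed (use assms in \<open>simp_all add: bop_lin cinner_lin positive_op_def\<close>)

text \<open>By Cauchy-Schwarz for the form of \<open>a\<close>, a null vector of the form is
  orthogonal to everything, hence in the kernel.\<close>

lemma positive_op_kernel:
  assumes "positive_op a" "Re (cinner (bop_apply a x) x) \<le> 0"
  shows "bop_apply a x = 0"
proof (rule cinner_ext)
  fix y
  have "Re (cinner (bop_apply a x) x) = 0"
    using assms by (metis antisym positive_op_def)
  then have "(cmod (cinner (bop_apply a x) y))\<^sup>2 \<le> 0"
    using positive_op_Cauchy_Schwarz[OF assms(1), of x y] by simp
  then show "cinner (bop_apply a x) y = cinner 0 y" by simp
qed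

lemma positive_op_zero: "positive_op 0"
  by (simp add: positive_op_def)

lemma positive_op_add: "positive_op a \<Longrightarrow> positive_op b \<Longrightarrow> positive_op (a + b)"
  by (simp add: positive_op_def cinner_lin)

lemma positive_op_sum: "(\<And>i. i \<in> A \<Longrightarrow> positive_op (f i)) \<Longrightarrow> positive_op (sum f A)"
  by (induction A rule: infinite_finite_induct) (simp_all add: positive_op_zero positive_op_add)

lemma cinner_outer_self: "cinner (bop_apply (outer x x) v) v = complex_of_real ((cmod (cinner v x))\<^sup>2)"
proof -
  have "cinner x v = cnj (cinner v x)" by (rule cinner_commute)
  then show ?thesis by (simp add: cinner_lin complex_mult_cnj cmod_power2)
qed

lemma positive_op_outer: "positive_op (outer x x)"
  unfolding positive_op_def cinner_outer_self by simp

lemma is_projectionI: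
  assumes "\<And>x y. cinner (bop_apply P x) y = cinner x (bop_apply P y)" "P * P = P"
  shows "is_projection P"
  unfolding is_projection_def using adjoint_eqI[of P P] assms by simp

lemma projection_symmetric:
  "is_projection P \<Longrightarrow> cinner (bop_apply P x) y = cinner x (bop_apply P y)"
  unfolding is_projection_def by (metis cinner_adjoint_right)

lemma projection_idem: "is_projection P \<Longrightarrow> bop_apply P (bop_apply P x) = bop_apply P x"
  unfolding is_projection_def by (metis bop_apply_times)

text \<open>The form of \<open>Q\<close> vanishes on vectors x - Q x, so 0 \<le> a \<le> Q forces
  \<open>a\<close> to kill them. The second identity is the adjoint of the first.\<close>

lemma below_projection:
  assumes a: "positive_op a" and Q: "is_projection Q" and le: "positive_op (Q - a)"
  shows "a * Q = a" "Q * a = a"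
proof -
  have "bop_apply a (x - bop_apply Q x) = 0" for x
  proof (rule positive_op_kernel[OF a])
    have "0 \<le> Re (cinner (bop_apply (Q - a) (x - bop_apply Q x)) (x - bop_apply Q x))"
      using le unfolding positive_op_def by blast
    moreover have "bop_apply Q (x - bop_apply Q x) = 0"
      by (simp add: bop_lin projection_idem[OF Q])
    ultimately show "Re (cinner (bop_apply a (x - bop_apply Q x)) (x - bop_apply Q x)) \<le> 0"
      by (simp add: cinner_lin)
  qed
  then have *: "bop_apply a (bop_apply Q x) = bop_apply a x" for x by (simp add: bop_lin)
  then show "a * Q = a" by (intro bop_eqI) simp
  show "Q * a = a"
    by (intro bop_eqI cinner_ext)
      (simp add: projection_symmetric[OF Q] positive_op_symmetric[OF a] *)
qed

section \<open>Projections of finite rank\<close>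

definition orthonormal_set :: "'a::complex_inner set \<Rightarrow> bool" where
  "orthonormal_set B \<longleftrightarrow> (\<forall>x\<in>B. \<forall>y\<in>B. cinner x y = (if x = y then 1 else 0))"

text \<open>For finite orthonormal \<open>B\<close> this is the orthogonal projection onto the span;
  for infinite \<open>B\<close> the sum has the default value 0.\<close>

definition proj_on :: "'a::complex_inner set \<Rightarrow> 'a bop" where
  "proj_on B = (\<Sum>b\<in>B. outer b b)"

lemma proj_on_apply: "bop_apply (proj_on B) x = (\<Sum>b\<in>B. cinner x b *\<^sub>C b)"
  by (simp add: proj_on_def bop_apply_sum)

lemma orthonormal_set_subset: "orthonormal_set B \<Longrightarrow> A \<subseteq> B \<Longrightarrow> orthonormal_set A"
  unfolding orthonormal_set_def by blast

lemma cinner_proj_on: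
  assumes "orthonormal_set B" "finite B" "b \<in> B"
  shows "cinner (bop_apply (proj_on B) x) b = cinner x b"
proof -
  have "cinner (bop_apply (proj_on B) x) b = (\<Sum>c\<in>B. if c = b then cinner x c else 0)"
    unfolding proj_on_apply cinner_sum_left
    by (rule sum.cong) (use assms in \<open>auto simp: orthonormal_set_def cinner_lin\<close>)
  also have "\<dots> = cinner x b" using assms by simp
  finally show ?thesis .
qed

lemma proj_on_basis_vector:
  assumes "orthonormal_set B" "finite B" "b \<in> B"
  shows "bop_apply (proj_on B) b = b"
proof -
  have "bop_apply (proj_on B) b = (\<Sum>c\<in>B. (if c = b then 1 else 0) *\<^sub>C c)"
    unfolding proj_on_apply
    by (rule sum.cong) (use assms in \<open>auto simp: orthonormal_set_def\<close>)
  also have "\<dots> = (\<Sum>c\<in>B. if c = b then c else 0)" by (rule sum.cong) auto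
  also have "\<dots> = b" using assms by simp
  finally show ?thesis .
qed

lemma proj_on_projection:
  assumes "orthonormal_set B" "finite B"
  shows "is_projection (proj_on B)"
proof (rule is_projectionI)
  show "cinner (bop_apply (proj_on B) x) y = cinner x (bop_apply (proj_on B) y)" for x y
    unfolding proj_on_apply cinner_sum_left cinner_sum_right
    by (rule sum.cong) (auto simp: cinner_lin cinner_commute[of y] mult.commute)
  show "proj_on B * proj_on B = proj_on B"
  proof (rule bop_eqI)
    fix x
    have "bop_apply (proj_on B) (bop_apply (proj_on B) x) = bop_apply (proj_on B) x"
      unfolding proj_on_apply[of B "bop_apply (proj_on B) x"]
      by (simp add: cinner_proj_on[OF assms]) (simp add: proj_on_apply)
    then show "bop_apply (proj_on B * proj_on B) x = bop_apply (proj_on B) x" by simp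
  qed
qed

lemma range_proj_on:
  assumes "orthonormal_set B" "finite B"
  shows "range (bop_apply (proj_on B)) = cspan B"
proof
  show "range (bop_apply (proj_on B)) \<subseteq> cspan B"
  proof
    fix y assume "y \<in> range (bop_apply (proj_on B))"
    then obtain x where "y = (\<Sum>b\<in>B. cinner x b *\<^sub>C b)" by (auto simp: proj_on_apply)
    then show "y \<in> cspan B"
      by (simp add: complex_vector.span_sum complex_vector.span_scale complex_vector.span_base)
  qed
  have "complex_vector.subspace (range (bop_apply (proj_on B)))"
    unfolding complex_vector.subspace_def
    by (auto simp flip: bop_lin intro: range_eqI[of _ _ 0])
  moreover have "B \<subseteq> range (bop_apply (proj_on B))"
    by (metis assms proj_on_basis_vector rangeI subsetI)
  ultimately show "cspan B \<subseteq> range (bop_apply (proj_on B))"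
    by (rule complex_vector.span_minimal[rotated])
qed

lemma orthonormal_set_independent:
  assumes "orthonormal_set B" "finite B"
  shows "\<not> complex_vector.dependent B"
proof
  assume "complex_vector.dependent B"
  then obtain u v where v: "v \<in> B" "u v \<noteq> 0" and u: "(\<Sum>b\<in>B. u b *\<^sub>C b) = 0"
    using complex_vector.dependent_finite[OF assms(2)] by blast
  have "cinner (\<Sum>b\<in>B. u b *\<^sub>C b) v = (\<Sum>b\<in>B. if b = v then u b else 0)"
    unfolding cinner_sum_left
    by (rule sum.cong) (use assms v in \<open>auto simp: orthonormal_set_def cinner_lin\<close>)
  also have "\<dots> = u v" using assms v by simp
  finally show False using u v by simp
qed

lemma op_rank_proj_on:
  assumes "orthonormal_set B" "finite B"
  shows "op_rank (proj_on B) = enat (card B)"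
proof -
  have "cdim (cspan B) = card B"
    using complex_vector.dim_span_eq_card_independent[OF orthonormal_set_independent[OF assms]] .
  moreover have "\<exists>C. finite C \<and> cspan B \<subseteq> cspan C" using assms by blast
  ultimately show ?thesis
    unfolding op_rank_def range_proj_on[OF assms] ecdim_def by simp
qed

lemma proj_on_rank_projections:
  assumes "orthonormal_set B" "finite B" "card B = k"
  shows "proj_on B \<in> rank_projections k"
  using assms by (simp add: rank_projections_def proj_on_projection op_rank_proj_on)

lemma positive_op_one_minus_projection:
  assumes "is_projection P"
  shows "positive_op (1 - P)"
  unfolding positive_op_def
proof
  fix x
  have "cinner (bop_apply (1 - P) x) x = cinner (x - bop_apply P x) (x - bop_apply P x)"
    using projection_symmetric[OF assms, of x x] projection_symmetric[OF assms, of x "bop_apply P x"]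
    by (simp add: cinner_lin projection_idem[OF assms])
  then show "Im (cinner (bop_apply (1 - P) x) x) = 0 \<and> 0 \<le> Re (cinner (bop_apply (1 - P) x) x)"
    by (simp add: cinner_self)
qed

section \<open>Gram-Schmidt extension of orthonormal sets\<close>

lemma orthonormal_set_insert_normalized:
  assumes "orthonormal_set B" "finite B" "w \<noteq> 0" "\<And>b. b \<in> B \<Longrightarrow> cinner w b = 0"
  defines "v \<equiv> complex_of_real (1 / norm w) *\<^sub>C w"
  shows "orthonormal_set (insert v B)" "v \<notin> B"
proof -
  have vb: "cinner v b = 0" if "b \<in> B" for b using assms that by (simp add: cinner_lin)
  have bv: "cinner b v = 0" if "b \<in> B" for b using vb[OF that] by (metis cinner_commute complex_cnj_zero)
  have vv: "cinner v v = 1"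
    using assms(3) unfolding v_def cinner_lin by (simp add: cinner_self power2_eq_square)
  show "v \<notin> B" using vb vv by fastforce
  then show "orthonormal_set (insert v B)"
    using assms(1) vb bv vv unfolding orthonormal_set_def by auto
qed

text \<open>If \<open>B\<close> spanned the space, the dimension would be \<open>card B\<close>, at
  most \<open>k\<close>. So some vector lies outside the span, and its residual after projection is
  normalised.\<close>

lemma orthonormal_set_extend_by_one:
  assumes "enat k < ecdim (UNIV :: 'a::complex_inner set)"
    and B: "orthonormal_set (B :: 'a set)" "finite B" "card B \<le> k"
  shows "\<exists>v. orthonormal_set (insert v B) \<and> v \<notin> B"
proof -
  have "cspan B \<noteq> UNIV"
  proof
    assume eq: "cspan B = UNIV"
    then have "cdim (UNIV :: 'a set) = card B"
      using complex_vector.dim_span_eq_card_independent[OF orthonormal_set_independent[OF B(1,2)]] by simp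
    moreover have "\<exists>B. finite B \<and> (UNIV :: 'a set) \<subseteq> cspan B" using eq B by blast
    ultimately have "ecdim (UNIV :: 'a set) = enat (card B)" by (simp add: ecdim_def)
    with assms(1) B(3) show False by simp
  qed
  then obtain x where x: "x \<notin> cspan B" by blast
  define w where "w = x - bop_apply (proj_on B) x"
  have "w \<noteq> 0" using x range_proj_on[OF B(1,2)] unfolding w_def by (metis eq_iff_diff_eq_0 rangeI)
  moreover have "cinner w b = 0" if "b \<in> B" for b
    using that by (simp add: w_def cinner_lin cinner_proj_on[OF B(1,2)])
  ultimately show ?thesis using orthonormal_set_insert_normalized[OF B(1,2)] by metis
qed

text \<open>Sizes up to \<open>Suc k\<close> are reachable because each single extension starts from
  at most \<open>k\<close> vectors.\<close>

lemma orthonormal_set_extend: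
  assumes "enat k < ecdim (UNIV :: 'a::complex_inner set)"
    and B: "orthonormal_set (B :: 'a set)" "finite B" "card B \<le> n" and "n \<le> Suc k"
  shows "\<exists>C. B \<subseteq> C \<and> orthonormal_set C \<and> finite C \<and> card C = n"
  using \<open>card B \<le> n\<close> \<open>n \<le> Suc k\<close>
proof (induction n rule: dec_induct)
  case base
  then show ?case using B by blast
next
  case (step m)
  then obtain C where C: "B \<subseteq> C" "orthonormal_set C" "finite C" "card C = m" by auto
  with step obtain v where "orthonormal_set (insert v C)" "v \<notin> C"
    using orthonormal_set_extend_by_one[OF assms(1)] by (metis Suc_le_mono)
  with C show ?case by (intro exI[of _ "insert v C"]) auto
qed

text \<open>Orthonormal sets inside the range have at most \<open>card F\<close> elements, so one of
  maximal size exists. A range vector not fixed by its projection would enlarge it.\<close>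

lemma finite_rank_projection_eq_proj_on:
  assumes P: "is_projection P" and F: "finite F" "range (bop_apply P) \<subseteq> cspan F"
  shows "\<exists>B. orthonormal_set B \<and> finite B \<and> B \<subseteq> range (bop_apply P) \<and> P = proj_on B"
proof -
  define \<O> where "\<O> = {B. orthonormal_set B \<and> finite B \<and> B \<subseteq> range (bop_apply P)}"
  have bound: "card B \<le> card F" if "B \<in> \<O>" for B
    using complex_vector.independent_span_bound[OF F(1) orthonormal_set_independent[of B]] that F(2)
    unfolding \<O>_def by blast
  have ex: "{} \<in> \<O>" by (simp add: \<O>_def orthonormal_set_def)
  obtain B where B: "B \<in> \<O>" and max: "\<And>C. C \<in> \<O> \<Longrightarrow> card C \<le> card B"
    using Lattices_Big.ex_has_greatest_nat[of "\<lambda>B. B \<in> \<O>" "{}" card "Suc (card F)"] ex bound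
    by (auto simp: less_Suc_eq_le)
  have B': "orthonormal_set B" "finite B" "B \<subseteq> range (bop_apply P)" using B by (auto simp: \<O>_def)
  have PB: "bop_apply P b = b" if "b \<in> B" for b
    using that B'(3) projection_idem[OF P] by auto
  have fix_range: "bop_apply (proj_on B) v = v" if v: "v \<in> range (bop_apply P)" for v
  proof (rule ccontr)
    assume neq: "bop_apply (proj_on B) v \<noteq> v"
    define w where "w = v - bop_apply (proj_on B) v"
    define u where "u = complex_of_real (1 / norm w) *\<^sub>C w"
    have "w \<noteq> 0" using neq by (simp add: w_def)
    moreover have "cinner w b = 0" if "b \<in> B" for b
      using that by (simp add: w_def cinner_lin cinner_proj_on[OF B'(1,2)])
    ultimately have u: "orthonormal_set (insert u B)" "u \<notin> B"
      unfolding u_def using orthonormal_set_insert_normalized[OF B'(1,2)] by blast+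
    \<comment> \<open>Both \<open>v\<close> and its projection are fixed by \<open>P\<close>, so the
      new unit vector \<open>u\<close> still lies in the range of \<open>P\<close>.\<close>
    have "bop_apply P (bop_apply (proj_on B) v) = bop_apply (proj_on B) v"
    proof -
      have "bop_apply P (bop_apply (proj_on B) v) = bop_apply (P * proj_on B) v" by simp
      also have "P * proj_on B = proj_on B"
        unfolding proj_on_def sum_distrib_left
        by (intro sum.cong bop_eqI) (simp_all add: bop_lin PB)
      finally show ?thesis .
    qed
    moreover have "bop_apply P v = v" using v projection_idem[OF P] by auto
    ultimately have "bop_apply P u = u" by (simp add: u_def w_def bop_lin)
    then have "insert u B \<in> \<O>" using u B' by (auto simp: \<O>_def intro: range_eqI[of _ _ u])
    from max[OF this] u(2) B'(2) show False by simp
  qed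
  have "P = proj_on B"
  proof (rule bop_eqI)
    fix x
    have "cinner (bop_apply P x) b = cinner x b" if "b \<in> B" for b
      by (simp add: projection_symmetric[OF P] PB[OF that])
    then have "bop_apply (proj_on B) (bop_apply P x) = bop_apply (proj_on B) x"
      by (simp add: proj_on_apply)
    then show "bop_apply P x = bop_apply (proj_on B) x" using fix_range[of "bop_apply P x"] by simp
  qed
  with B' show ?thesis by blast
qed

lemma rank_projections_finite_range:
  assumes "P \<in> rank_projections k"
  shows "\<exists>F. finite F \<and> range (bop_apply P) \<subseteq> cspan F"
  using assms unfolding rank_projections_def op_rank_def ecdim_def
  by (auto split: if_splits)

lemma rank_projections_eq_proj_on:
  assumes "P \<in> rank_projections k"
  shows "\<exists>B. orthonormal_set B \<and> finite B \<and> card B = k \<and> P = proj_on B"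
proof -
  obtain F where "finite F" "range (bop_apply P) \<subseteq> cspan F"
    using rank_projections_finite_range[OF assms] by blast
  then obtain B where B: "orthonormal_set B" "finite B" "P = proj_on B"
    using finite_rank_projection_eq_proj_on assms unfolding rank_projections_def by blast
  then have "card B = k"
    using assms op_rank_proj_on[OF B(1,2)] unfolding rank_projections_def by auto
  with B show ?thesis by blast
qed

section \<open>Images of rank one projections\<close>

lemma one_minus_projection: "is_projection P \<Longrightarrow> is_projection (1 - P)"
  by (rule is_projectionI)
    (simp_all add: cinner_lin projection_symmetric algebra_simps is_projection_def)

text \<open>\<open>preserves\<close> is one half of the surjectivity hypothesis; the other half
  enters as \<open>onto\<close> in \<open>representing_map_surj\<close>.\<close>

locale rank_projection_preserver =
  fixes k :: nat and \<phi> :: "'h::chilbert_space bop \<Rightarrow> 'h bop"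
  assumes k_pos: "1 \<le> k" and k_less_dim: "enat k < ecdim (UNIV :: 'h set)"
    and lin: "clinear \<phi>" and pos: "positive_map \<phi>" and unital: "\<phi> 1 = 1"
    and preserves: "\<phi> ` rank_projections k \<subseteq> rank_projections k"
begin

lemma map_add: "\<phi> (a + b) = \<phi> a + \<phi> b"
  using lin by (simp add: clinear_iff)

lemma map_scaleC: "\<phi> (c *\<^sub>C a) = c *\<^sub>C \<phi> a"
  using lin by (simp add: clinear_iff)

lemma map_zero: "\<phi> 0 = 0"
  using map_scaleC[of 0 0] by simp

lemma map_diff: "\<phi> (a - b) = \<phi> a - \<phi> b"
  unfolding minus_bop_def map_add map_scaleC ..

lemma map_sum: "\<phi> (sum f A) = (\<Sum>i\<in>A. \<phi> (f i))"
  by (induction A rule: infinite_finite_induct) (simp_all add: map_zero map_add)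

lemma map_positive: "positive_op a \<Longrightarrow> positive_op (\<phi> a)"
  using pos by (simp add: positive_map_def)

lemma map_orthonormal_set:
  assumes C: "orthonormal_set C" "finite C" "card C = Suc k"
  shows "\<exists>f. (\<forall>b\<in>C. \<phi> (outer b b) = outer (f b) (f b) \<and> norm (f b) = 1) \<and>
    (\<forall>b\<in>C. \<forall>d\<in>C. b \<noteq> d \<longrightarrow> cinner (f b) (f d) = 0)"
proof -
  define a where "a b = \<phi> (outer b b)" for b
  \<comment> \<open>Each \<open>Q d\<close> is the image of a rank \<open>k\<close> projection,
    obtained by omitting \<open>d\<close> from the \<open>k + 1\<close> vectors.\<close>
  define Q where "Q d = \<phi> (proj_on (C - {d}))" for d
  have Q_sum: "Q d = (\<Sum>c\<in>C - {d}. a c)" for d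
    by (simp add: Q_def proj_on_def map_sum a_def)
  have Q: "Q d \<in> rank_projections k" if "d \<in> C" for d
  proof -
    have "proj_on (C - {d}) \<in> rank_projections k"
      by (rule proj_on_rank_projections[OF orthonormal_set_subset[OF C(1)]]) (use C that in auto)
    then show ?thesis using preserves by (auto simp: Q_def)
  qed
  then have Q_proj: "is_projection (Q d)" if "d \<in> C" for d
    using that by (simp add: rank_projections_def)
  have a_pos: "positive_op (a b)" for b
    unfolding a_def by (rule map_positive) (rule positive_op_outer)
  have below: "a b * Q d = a b" "Q d * a b = a b" if "b \<in> C" "d \<in> C" "b \<noteq> d" for b d
  proof -
    have "Q d = a b + (\<Sum>c\<in>C - {d} - {b}. a c)"
      unfolding Q_sum by (rule sum.remove) (use C that in auto)
    then have "Q d - a b = (\<Sum>c\<in>C - {d} - {b}. a c)" by simp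
    then have "positive_op (Q d - a b)" using positive_op_sum a_pos by metis
    then show "a b * Q d = a b" "Q d * a b = a b"
      using below_projection[OF a_pos Q_proj[OF that(2)]] by blast+
  qed
  \<comment> \<open>Positivity of the image of 1 - \<open>proj_on C\<close> places
    \<open>a d\<close> below the projection 1 - \<open>Q d\<close>.\<close>
  have orth_Q: "Q d * a d = 0" if "d \<in> C" for d
  proof -
    have "proj_on C = outer d d + proj_on (C - {d})"
      unfolding proj_on_def by (rule sum.remove) (use C that in auto)
    then have "\<phi> (1 - proj_on C) = (1 - Q d) - a d"
      by (simp add: map_diff map_add unital Q_def a_def)
    then have "positive_op ((1 - Q d) - a d)"
      by (metis map_positive positive_op_one_minus_projection proj_on_projection C(1,2))
    then have "(1 - Q d) * a d = a d"
      using below_projection[OF a_pos one_minus_projection[OF Q_proj[OF that]]] by blast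
    then show ?thesis by (simp add: algebra_simps)
  qed
  \<comment> \<open>\<open>Q d\<close> absorbs \<open>a b\<close> and annihilates
    \<open>a d\<close>, so it can be inserted between the two factors.\<close>
  have orth: "a b * a d = 0" if "b \<in> C" "d \<in> C" "b \<noteq> d" for b d
  proof -
    have "a b * a d = a b * (Q d * a d)" by (metis below(1) that mult.assoc)
    then show ?thesis by (simp add: orth_Q that)
  qed
  \<comment> \<open>Here \<open>k\<close> at least 1 matters: \<open>C\<close> has at least two
    elements, so each \<open>a b\<close> is a summand of some \<open>Q d\<close>.\<close>
  have ex_other: "\<exists>d\<in>C. d \<noteq> b" for b
  proof (rule ccontr)
    assume "\<not> (\<exists>d\<in>C. d \<noteq> b)"
    then have "C \<subseteq> {b}" by blast
    then have "card C \<le> 1" using card_mono[of "{b}" C] by simp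
    then show False using C(3) k_pos by simp
  qed
  \<comment> \<open>In \<open>a b = a b * Q d\<close> every summand of \<open>Q d\<close> other than
    \<open>a b\<close> is annihilated.\<close>
  have idem: "a b * a b = a b" if "b \<in> C" for b
  proof -
    obtain d where d: "d \<in> C" "d \<noteq> b" using ex_other by blast
    have "a b = a b * (\<Sum>c\<in>C - {d}. a c)" using below(1) that d Q_sum by metis
    also have "\<dots> = a b * a b + (\<Sum>c\<in>C - {d} - {b}. a b * a c)"
      unfolding sum_distrib_left by (rule sum.remove) (use C that d in auto)
    also have "(\<Sum>c\<in>C - {d} - {b}. a b * a c) = 0"
      by (rule sum.neutral) (use orth that in auto)
    finally show ?thesis by simp
  qed
  have a_proj: "is_projection (a b)" if "b \<in> C" for b
    by (rule is_projectionI) (use positive_op_symmetric[OF a_pos] idem that in auto)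
  \<comment> \<open>\<open>a b\<close> has finite rank because its range lies in that of a suitable
    \<open>Q d\<close>.\<close>
  have "\<exists>B. orthonormal_set B \<and> finite B \<and> B \<subseteq> range (bop_apply (a b)) \<and> a b = proj_on B"
    if "b \<in> C" for b
  proof -
    obtain d where d: "d \<in> C" "d \<noteq> b" using ex_other by blast
    have "bop_apply (a b) x = bop_apply (Q d) (bop_apply (a b) x)" for x
      using below(2)[OF that d(1)] d(2) by (metis bop_apply_times)
    then have "range (bop_apply (a b)) \<subseteq> range (bop_apply (Q d))" by blast
    moreover obtain F where "finite F" "range (bop_apply (Q d)) \<subseteq> cspan F"
      using rank_projections_finite_range[OF Q[OF d(1)]] by blast
    ultimately show ?thesis
      using finite_rank_projection_eq_proj_on[OF a_proj[OF that]] by blast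
  qed
  then obtain B where B: "\<And>b. b \<in> C \<Longrightarrow> orthonormal_set (B b)" "\<And>b. b \<in> C \<Longrightarrow> finite (B b)"
    "\<And>b. b \<in> C \<Longrightarrow> a b = proj_on (B b)" by metis
  have ab: "bop_apply (a b) x = x" if "b \<in> C" "x \<in> B b" for b x
    using B[OF that(1)] proj_on_basis_vector that(2) by metis
  have B_orth: "cinner x y = 0" if "b \<in> C" "d \<in> C" "b \<noteq> d" "x \<in> B b" "y \<in> B d" for b d x y
  proof -
    have "cinner x y = cinner (bop_apply (a b) x) (bop_apply (a d) y)" using ab that by metis
    also have "\<dots> = cinner x (bop_apply (a b * a d) y)"
      by (simp add: positive_op_symmetric[OF a_pos])
    finally show ?thesis using orth that by simp
  qed
  have B_self: "cinner x x = 1" if "b \<in> C" "x \<in> B b" for b x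
    using B(1)[OF that(1)] that(2) unfolding orthonormal_set_def by auto
  have B_disj: "B b \<inter> B d = {}" if "b \<in> C" "d \<in> C" "b \<noteq> d" for b d
    using B_orth[OF that] B_self that by fastforce
  \<comment> \<open>The sets \<open>B c\<close> are mutually orthogonal, so their union is an
    orthonormal basis of the range of \<open>Q d\<close>, and ranks add up to
    \<open>k\<close>.\<close>
  have card_B: "(\<Sum>c\<in>C - {d}. card (B c)) = k" if "d \<in> C" for d
  proof -
    define D where "D = (\<Union>c\<in>C - {d}. B c)"
    have "finite D" using C B by (auto simp: D_def)
    moreover have "orthonormal_set D"
      unfolding orthonormal_set_def
    proof (intro ballI)
      fix x y assume "x \<in> D" "y \<in> D"
      then obtain b c where bc: "b \<in> C" "c \<in> C" "x \<in> B b" "y \<in> B c" by (auto simp: D_def)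
      show "cinner x y = (if x = y then 1 else 0)"
      proof (cases "b = c")
        case True
        then show ?thesis using bc B(1) unfolding orthonormal_set_def by auto
      next
        case False
        then show ?thesis using bc B_orth B_disj[of b c] by auto
      qed
    qed
    moreover have "Q d = proj_on D"
    proof -
      have "proj_on D = (\<Sum>c\<in>C - {d}. proj_on (B c))"
        unfolding D_def proj_on_def by (rule sum.UNION_disjoint) (use C B B_disj in auto)
      also have "\<dots> = Q d" unfolding Q_sum by (rule sum.cong) (use B in auto)
      finally show ?thesis by simp
    qed
    ultimately have "card D = k"
      using op_rank_proj_on Q[OF that] by (simp add: rank_projections_def op_rank_proj_on)
    moreover have "card D = (\<Sum>c\<in>C - {d}. card (B c))"
      unfolding D_def by (rule card_UN_disjoint) (use C B B_disj in auto)
    ultimately show ?thesis by simp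
  qed
  \<comment> \<open>The total rank exceeds the rank of \<open>a d\<close> by \<open>k\<close> for
    every \<open>d\<close>, so all ranks agree; \<open>k\<close> equal ranks with sum
    \<open>k\<close> are all 1.\<close>
  have card_one: "card (B b) = 1" if "b \<in> C" for b
  proof -
    have total: "(\<Sum>c\<in>C. card (B c)) = card (B d) + k" if "d \<in> C" for d
      using sum.remove[OF C(2) that, of "\<lambda>c. card (B c)"] card_B[OF that] by simp
    have same: "card (B c) = card (B b)" if "c \<in> C" for c
      using total[OF that] total[OF \<open>b \<in> C\<close>] by simp
    have "(\<Sum>c\<in>C - {b}. card (B c)) = (\<Sum>c\<in>C - {b}. card (B b))"
      by (rule sum.cong) (use same in auto)
    also have "\<dots> = k * card (B b)" using C that by simp
    finally show ?thesis using card_B[OF that] k_pos by simp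
  qed
  then have "\<exists>x. B b = {x}" if "b \<in> C" for b using that by (metis card_1_singletonE)
  then obtain f where f: "\<And>b. b \<in> C \<Longrightarrow> B b = {f b}" by metis
  have "\<phi> (outer b b) = outer (f b) (f b)" if "b \<in> C" for b
    using B(3)[OF that] by (simp add: a_def f[OF that] proj_on_def)
  moreover have "norm (f b) = 1" if "b \<in> C" for b
    using B_self[OF that, of "f b"] f[OF that] by (simp add: norm_eq_sqrt_cinner)
  moreover have "cinner (f b) (f d) = 0" if "b \<in> C" "d \<in> C" "b \<noteq> d" for b d
    using B_orth[OF that] f that by simp
  ultimately show ?thesis by blast
qed

text \<open>By homogeneity a unit vector suffices, and it belongs to some \<open>k + 1\<close>
  orthonormal vectors.\<close>

lemma map_outer_self: "\<exists>w. \<phi> (outer z z) = outer w w \<and> norm w = norm z"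
proof (cases "z = 0")
  case True
  have "outer (0::'h) 0 = 0" by (rule bop_eqI) simp
  then show ?thesis using True map_zero by (intro exI[of _ 0]) simp
next
  case False
  define u where "u = complex_of_real (1 / norm z) *\<^sub>C z"
  have u: "cinner u u = 1" and z: "z = complex_of_real (norm z) *\<^sub>C u"
    using False unfolding u_def cinner_lin by (simp_all add: cinner_self power2_eq_square scaleC_scaleC)
  have "orthonormal_set {u}" using u by (simp add: orthonormal_set_def)
  then obtain C where C: "u \<in> C" "orthonormal_set C" "finite C" "card C = Suc k"
    using orthonormal_set_extend[OF k_less_dim, of "{u}" "Suc k"] by auto
  then obtain w where w: "\<phi> (outer u u) = outer w w" "norm w = 1"
    using map_orthonormal_set[OF C(2-4)] by blast
  have "\<phi> (outer z z) = outer (complex_of_real (norm z) *\<^sub>C w) (complex_of_real (norm z) *\<^sub>C w)"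
    by (subst (1 2) z) (simp add: outer_lin map_scaleC w)
  then show ?thesis using w by (metis norm_scaleC norm_of_real abs_norm_cancel mult.right_neutral)
qed

text \<open>After normalisation the pair extends to \<open>k + 1\<close> orthonormal vectors, which
  is possible since \<open>k + 1\<close> is at least 2.\<close>

lemma map_outer_orthogonal:
  assumes "cinner x y = 0"
  shows "\<phi> (outer x x) * \<phi> (outer y y) = 0"
proof (cases "x = 0 \<or> y = 0")
  case True
  have "outer (0::'h) 0 = 0" by (rule bop_eqI) simp
  then show ?thesis using True map_zero by auto
next
  case False
  define u v where "u = complex_of_real (1 / norm x) *\<^sub>C x" and "v = complex_of_real (1 / norm y) *\<^sub>C y"
  have u: "cinner u u = 1" and x: "x = complex_of_real (norm x) *\<^sub>C u"
    using False unfolding u_def cinner_lin by (simp_all add: cinner_self power2_eq_square scaleC_scaleC)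
  have v: "cinner v v = 1" and y: "y = complex_of_real (norm y) *\<^sub>C v"
    using False unfolding v_def cinner_lin by (simp_all add: cinner_self power2_eq_square scaleC_scaleC)
  have uv: "cinner u v = 0" using assms by (simp add: u_def v_def cinner_lin)
  then have vu: "cinner v u = 0" by (metis cinner_commute complex_cnj_zero)
  have neq: "u \<noteq> v" using u uv by auto
  have "orthonormal_set {u, v}" using u v uv vu by (auto simp: orthonormal_set_def)
  then obtain C where C: "u \<in> C" "v \<in> C" "orthonormal_set C" "finite C" "card C = Suc k"
    using orthonormal_set_extend[OF k_less_dim, of "{u, v}" "Suc k"] k_pos neq by auto
  obtain w t where w: "\<phi> (outer u u) = outer w w" "\<phi> (outer v v) = outer t t" "cinner w t = 0"
    using map_orthonormal_set[OF C(3-5)] C(1,2) neq by blast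
  have "cinner t w = 0" using w by (metis cinner_commute complex_cnj_zero)
  then have 0: "outer w w * outer t t = 0" by (intro bop_eqI) (simp add: cinner_lin)
  show ?thesis
    by (subst (1 2) x, subst (1 2) y) (intro bop_eqI, simp add: outer_lin map_scaleC w bop_lin 
        \<open>cinner t w = 0\<close> cinner_lin)
qed

end

lemma outer_eq_zero: "outer x y = 0 \<Longrightarrow> x = 0 \<or> y = 0"
proof -
  assume "outer x y = 0"
  then have "cinner y y *\<^sub>C x = 0" by (metis outer_apply bop_apply_zero)
  then show ?thesis by (auto simp: cinner_eq_zero_iff)
qed

text \<open>Equal quadratic forms give |<v,x>| = |<v,y>| for all v; v = x and v = y identify both
  squared norms with |<x,y>|. This makes the representing map isometric.\<close>

lemma outer_self_eq_norm:
  assumes "outer x x = outer y y"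
  shows "norm x = norm y"
proof -
  have "(cmod (cinner v x))\<^sup>2 = (cmod (cinner v y))\<^sup>2" for v
    using cinner_outer_self[of x v] cinner_outer_self[of y v] assms by (metis of_real_eq_iff)
  then have eq: "cmod (cinner v x) = cmod (cinner v y)" for v by simp
  have "(norm x)\<^sup>2 = cmod (cinner x y)" using eq[of x] by (simp add: cinner_self norm_power)
  moreover have "(norm y)\<^sup>2 = cmod (cinner y x)" using eq[of y] by (simp add: cinner_self norm_power)
  moreover have "cmod (cinner x y) = cmod (cinner y x)" by (metis cinner_commute complex_mod_cnj)
  ultimately have "(norm x)\<^sup>2 = (norm y)\<^sup>2" by simp
  then show ?thesis by simp
qed

section \<open>The linear or antilinear map representing the images of rank one projections\<close>

context rank_projection_preserver
begin

text \<open>\<open>V\<close> is \<open>T\<close> in the linear case and \<open>S\<close> in the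
  antilinear case; both send \<open>e\<close> to \<open>f\<close>.\<close>

lemma linear_or_antilinear:
  "\<exists>V. (\<forall>u. \<phi> (outer u u) = outer (V u) (V u)) \<and> (\<forall>x y. V (x + y) = V x + V y) \<and>
    ((\<forall>c x. V (c *\<^sub>C x) = c *\<^sub>C V x) \<or> (\<forall>c x. V (c *\<^sub>C x) = cnj c *\<^sub>C V x))"
proof -
  have "orthonormal_set ({} :: 'h set)" by (simp add: orthonormal_set_def)
  then obtain C :: "'h set" where "orthonormal_set C" "card C = 1"
    using orthonormal_set_extend[OF k_less_dim, of "{}" 1] by auto
  then obtain e where e: "cinner e (e::'h) = 1"
    by (metis card_1_singletonE insertI1 orthonormal_set_def)
  obtain f where f: "\<phi> (outer e e) = outer f f" and "norm f = norm e"
    using map_outer_self by blast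
  then have ff: "cinner f f = 1" using e by (simp add: cinner_self)
  define T where "T z = bop_apply (\<phi> (outer z e)) f" for z
  define S where "S z = bop_apply (\<phi> (outer e z)) f" for z
  have T_add: "T (x + y) = T x + T y" and T_scale: "T (c *\<^sub>C x) = c *\<^sub>C T x" for x y c
    by (simp_all add: T_def outer_lin map_add map_scaleC)
  have S_add: "S (x + y) = S x + S y" and S_scale: "S (c *\<^sub>C x) = cnj c *\<^sub>C S x" for x y c
    by (simp_all add: S_def outer_lin map_add map_scaleC)
  have Te: "T e = f" and Se: "S e = f" by (simp_all add: T_def S_def f ff)
  define D where "D u = \<phi> (outer u u)" for u
  have D_expand: "D (z + c *\<^sub>C e) = D z + cnj c *\<^sub>C \<phi> (outer z e) + c *\<^sub>C \<phi> (outer e z)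
      + (c * cnj c) *\<^sub>C outer f f" for z c
    unfolding D_def by (simp add: outer_lin map_add map_scaleC f scaleC_add_right scaleC_scaleC mult.commute)
  define g where "g c z = (c * cnj c) *\<^sub>C f + cnj c *\<^sub>C T z + c *\<^sub>C S z" for c z
  have Df: "bop_apply (D z) f = 0" if "cinner z e = 0" for z
  proof -
    have "bop_apply (D z * outer f f) f = 0"
      using map_outer_orthogonal[OF that] f by (simp add: D_def)
    then show ?thesis by (simp add: ff)
  qed
  have g: "bop_apply (D (z + c *\<^sub>C e)) f = g c z" if "cinner z e = 0" for z c
    unfolding D_expand by (simp add: Df[OF that] g_def T_def S_def ff)
  \<comment> \<open>The form of \<open>D (z + c *\<^sub>C e)\<close> at \<open>f\<close> is |c|^2
    plus terms linear in c. Nonnegativity along the real and imaginary axes gives two equations, and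
    realness at c = 1 and c = i the other two.\<close>
  have TS_perp: "cinner (T z) f = 0 \<and> cinner (S z) f = 0" if z: "cinner z e = 0" for z
  proof -
    define \<tau> \<sigma> where "\<tau> = cinner (T z) f" and "\<sigma> = cinner (S z) f"
    have form: "Im (c * cnj c + cnj c * \<tau> + c * \<sigma>) = 0 \<and> 0 \<le> Re (c * cnj c + cnj c * \<tau> + c * \<sigma>)" for c
    proof -
      have "positive_op (D (z + c *\<^sub>C e))" unfolding D_def by (intro map_positive positive_op_outer)
      then have "Im (cinner (g c z) f) = 0 \<and> 0 \<le> Re (cinner (g c z) f)"
        using g[OF z] unfolding positive_op_def by metis
      then show ?thesis by (simp add: g_def cinner_lin ff \<tau>_def \<sigma>_def)
    qed
    have lin0: "R = 0" if "\<And>r::real. 0 \<le> r\<^sup>2 + r * R" for R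
    proof -
      have "R\<^sup>2 \<le> 0" using that[of "- R / 2"] by (simp add: power2_eq_square)
      then show ?thesis by simp
    qed
    have "Re \<tau> + Re \<sigma> = 0"
      by (rule lin0) (use form[of "complex_of_real r" for r] in \<open>simp add: power2_eq_square algebra_simps\<close>)
    moreover have "Im \<tau> - Im \<sigma> = 0"
      by (rule lin0) (use form[of "\<i> * complex_of_real r" for r] in \<open>simp add: power2_eq_square algebra_simps\<close>)
    moreover have "Im \<tau> + Im \<sigma> = 0" using form[of 1] by simp
    moreover have "Re \<sigma> - Re \<tau> = 0" using form[of \<i>] by simp
    ultimately show ?thesis by (simp add: \<tau>_def[symmetric] \<sigma>_def[symmetric] complex_eq_iff)
  qed
  text \<open>A rank one positive operator is determined by its value at \<open>f\<close>.\<close>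
  have gg: "outer (g c z) (g c z) = (c * cnj c) *\<^sub>C D (z + c *\<^sub>C e)" if z: "cinner z e = 0" for c z
  proof -
    obtain w where w: "D (z + c *\<^sub>C e) = outer w w" unfolding D_def using map_outer_self by blast
    have gw: "g c z = cinner f w *\<^sub>C w" using g[OF z, of c] w by simp
    \<comment> \<open>The squared modulus of the unknown factor \<open>cinner f w\<close> is the
      \<open>f\<close> component of \<open>g c z\<close>, which \<open>TS_perp\<close> shows to be
      |c|^2.\<close>
    have "cinner (g c z) f = c * cnj c"
      unfolding g_def using TS_perp[OF z] by (simp add: cinner_lin ff)
    moreover have "cinner (g c z) f = cinner f w * cnj (cinner f w)"
      unfolding gw by (metis cinner_scaleC_left cinner_commute)
    ultimately show ?thesis
      unfolding w gw by (simp add: outer_lin scaleC_scaleC mult.commute)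
  qed
  define h where "h c z = cnj c *\<^sub>C T z + c *\<^sub>C S z" for c z
  \<comment> \<open>Adding \<open>gg\<close> for \<open>c\<close> and \<open>- c\<close> cancels the
    cross terms with \<open>f\<close> on both sides, leaving twice the two operators to be
    compared.\<close>
  have D_h: "D z = outer (h c z) (h c z)" if z: "cinner z e = 0" and c: "c * cnj c = 1" for c z
  proof -
    have c': "(- c) * cnj (- c) = 1" using c by simp
    have 1: "g c z = f + h c z" using c by (simp add: g_def h_def add.assoc)
    have 2: "g (- c) z = f - h c z" using c by (simp add: g_def h_def scaleC_minus_left algebra_simps)
    have "outer (f + h c z) (f + h c z) + outer (f - h c z) (f - h c z)
        = D (z + c *\<^sub>C e) + D (z + (- c) *\<^sub>C e)"
      using gg[OF z, of c] gg[OF z, of "- c"] unfolding 1 2 c c' by simp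
    also have "\<dots> = 2 *\<^sub>C D z + 2 *\<^sub>C outer f f"
      unfolding D_expand c c'
      by (intro bop_eqI) (simp add: scaleC_minus_left complex_vector.scale_left_distrib[of 1 1, simplified])
    finally have eq: "outer (f + h c z) (f + h c z) + outer (f - h c z) (f - h c z)
      = 2 *\<^sub>C D z + 2 *\<^sub>C outer f f" .
    have "outer (f + h c z) (f + h c z) + outer (f - h c z) (f - h c z)
      = 2 *\<^sub>C outer (h c z) (h c z) + 2 *\<^sub>C outer f f"
      by (rule bop_eqI, rule cinner_ext) (simp add: cinner_lin algebra_simps)
    with eq have "2 *\<^sub>C D z = 2 *\<^sub>C outer (h c z) (h c z)" by simp
    then show ?thesis by simp
  qed
  have T_or_S: "S z = 0 \<or> T z = 0" if z: "cinner z e = 0" for z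
  proof -
    have "outer (S z) (T z) = 0"
    proof (rule bop_eqI, rule cinner_ext)
      fix v w
      \<comment> \<open>\<open>p\<close> and \<open>q\<close> are the coefficients of c^2 and of its
        conjugate in the form of \<open>outer (h c z) (h c z)\<close>, which does not vary with c on
        the unit circle. \<open>p\<close> is the form of \<open>outer (S z) (T z)\<close>.\<close>
      define p q where "p = cinner v (T z) * cinner (S z) w" and "q = cinner v (S z) * cinner (T z) w"
      define r where "r = cinner v (T z) * cinner (T z) w + cinner v (S z) * cinner (S z) w"
      have D_pq: "cinner (bop_apply (D z) v) w = r + c\<^sup>2 * p + (cnj c)\<^sup>2 * q" if c: "c * cnj c = 1" for c
      proof -
        have "cinner (bop_apply (D z) v) w = (c * cnj c) * r + c\<^sup>2 * p + (cnj c)\<^sup>2 * q"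
          unfolding D_h[OF z c] h_def p_def q_def r_def
          by (simp add: cinner_lin power2_eq_square algebra_simps)
        then show ?thesis using c by simp
      qed
      \<comment> \<open>The parameters 1, i and this one have squares 1, -1 and i. The first two
        give p + q = 0, the third then gives p = 0.\<close>
      define c where "c = csqrt \<i>"
      have c2: "c\<^sup>2 = \<i>" unfolding c_def by (rule power2_csqrt)
      then have "(cmod c)\<^sup>2 = 1" by (metis norm_power norm_ii)
      then have cc: "c * cnj c = 1" by (simp add: complex_mult_cnj cmod_power2[symmetric])
      have cnj_c2: "(cnj c)\<^sup>2 = - \<i>" by (metis c2 complex_cnj_power complex_cnj_i)
      have "r + p + q = r - p - q" using D_pq[of 1] D_pq[of \<i>] by simp
      then have "p * 2 + q * 2 = 0" by (simp add: algebra_simps)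
      then have "(p + q) * 2 = 0" by (simp only: distrib_right)
      then have "p + q = 0" by (metis mult_eq_0_iff zero_neq_numeral)
      then have q: "q = - p" by (rule minus_unique[symmetric])
      have "r + p + q = r + \<i> * p - \<i> * q" using D_pq[of 1] D_pq[OF cc] c2 cnj_c2 by simp
      then have "p = 0" using q by simp
      then show "cinner (bop_apply (outer (S z) (T z)) v) w = cinner (bop_apply 0 v) w"
        by (simp add: p_def cinner_lin)
    qed
    then show ?thesis by (rule outer_eq_zero)
  qed
  have decomp: "\<exists>z c. u = z + c *\<^sub>C e \<and> cinner z e = 0" for u
    by (intro exI[of _ "u - cinner u e *\<^sub>C e"] exI[of _ "cinner u e"]) (simp add: cinner_lin e)
  have cancel: "A = B" if "c \<noteq> 0" "(c * cnj c) *\<^sub>C A = (c * cnj c) *\<^sub>C B" for c and A B :: "'h bop"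
    using that by simp
  \<comment> \<open>From pointwise to uniform: with T x = 0, S x nonzero and S z = 0, T z nonzero,
    neither map would vanish at x + z.\<close>
  consider "\<And>z. cinner z e = 0 \<Longrightarrow> S z = 0" | "\<And>z. cinner z e = 0 \<Longrightarrow> T z = 0"
  proof (cases "\<exists>x. cinner x e = 0 \<and> S x \<noteq> 0")
    case True
    then obtain x where x: "cinner x e = 0" "S x \<noteq> 0" "T x = 0" using T_or_S by blast
    have "T z = 0" if z: "cinner z e = 0" for z
    proof (rule ccontr)
      assume "T z \<noteq> 0"
      then have "S z = 0" using T_or_S[OF z] by simp
      moreover have "S (x + z) = 0 \<or> T (x + z) = 0"
        by (rule T_or_S) (simp add: cinner_lin x z)
      ultimately show False using x \<open>T z \<noteq> 0\<close> by (simp add: S_add T_add)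
    qed
    then show ?thesis using that by blast
  qed (use that in blast)
  then show ?thesis
  proof cases
    case 1
    have "D u = outer (T u) (T u)" for u
    proof -
      obtain z c where u: "u = z + c *\<^sub>C e" and z: "cinner z e = 0" using decomp by blast
      \<comment> \<open>For nonzero c, \<open>g c z\<close> is a multiple of \<open>T u\<close> and
        the factor |c|^2 in \<open>gg\<close> cancels. For c = 0, where nothing can be cancelled,
        \<open>D_h\<close> with parameter 1 applies.\<close>
      show ?thesis
      proof (cases "c = 0")
        case True
        then show ?thesis using D_h[OF z, of 1] 1[OF z] u by (simp add: h_def)
      next
        case False
        have "g c z = cnj c *\<^sub>C T u"
          by (simp add: g_def u T_add T_scale Te 1[OF z] scaleC_add_right scaleC_scaleC mult.commute)
        then have gT: "outer (g c z) (g c z) = (c * cnj c) *\<^sub>C outer (T u) (T u)"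
          by (simp only: outer_scaleC_left outer_scaleC_right scaleC_scaleC complex_cnj_cnj mult.commute)
        show ?thesis
          by (rule cancel[OF False]) (use gT gg[OF z, of c] u in simp)
      qed
    qed
    then show ?thesis using T_add T_scale unfolding D_def by blast
  next
    case 2
    have "D u = outer (S u) (S u)" for u
    proof -
      obtain z c where u: "u = z + c *\<^sub>C e" and z: "cinner z e = 0" using decomp by blast
      show ?thesis
      proof (cases "c = 0")
        case True
        then show ?thesis using D_h[OF z, of 1] 2[OF z] u by (simp add: h_def)
      next
        case False
        have "g c z = c *\<^sub>C S u"
          by (simp add: g_def u S_add S_scale Se 2[OF z] scaleC_add_right scaleC_scaleC)
        then have gT: "outer (g c z) (g c z) = (c * cnj c) *\<^sub>C outer (S u) (S u)"
          by (simp only: outer_scaleC_left outer_scaleC_right scaleC_scaleC complex_cnj_cnj mult.commute)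
        show ?thesis
          by (rule cancel[OF False]) (use gT gg[OF z, of c] u in simp)
      qed
    qed
    then show ?thesis using S_add S_scale unfolding D_def by blast
  qed
qed

text \<open>Any unit vector lies in the range of a rank \<open>k\<close> projection. That projection
  is some \<open>\<phi> P\<close>, a finite sum of operators \<open>outer w w\<close> with w in
  \<open>M\<close>. Using a subspace \<open>M\<close> treats the linear and antilinear cases
  together.\<close>

lemma representing_map_surj:
  assumes onto: "rank_projections k \<subseteq> \<phi> ` rank_projections k"
    and M: "complex_vector.subspace M" and V: "\<And>u. \<exists>w\<in>M. \<phi> (outer u u) = outer w w"
  shows "M = UNIV"
proof -
  have "x \<in> M" for x :: 'h
  proof (cases "x = 0")
    case True
    then show ?thesis using M by (simp add: complex_vector.subspace_0)
  next
    case False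
    define u where "u = complex_of_real (1 / norm x) *\<^sub>C x"
    have u: "cinner u u = 1" and x: "x = complex_of_real (norm x) *\<^sub>C u"
      using False unfolding u_def cinner_lin by (simp_all add: cinner_self power2_eq_square scaleC_scaleC)
    have "orthonormal_set {u}" using u by (simp add: orthonormal_set_def)
    then obtain C where C: "u \<in> C" "orthonormal_set C" "finite C" "card C = k"
      using orthonormal_set_extend[OF k_less_dim, of "{u}" k] k_pos by auto
    then have "proj_on C \<in> rank_projections k" by (simp add: proj_on_rank_projections)
    then obtain P where P: "P \<in> rank_projections k" "proj_on C = \<phi> P" using onto by blast
    obtain B where B: "P = proj_on B" using rank_projections_eq_proj_on[OF P(1)] by blast
    obtain W where W: "\<And>b. W b \<in> M" "\<And>b. \<phi> (outer b b) = outer (W b) (W b)" using V by metis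
    have "\<phi> P = (\<Sum>b\<in>B. outer (W b) (W b))" by (simp add: B proj_on_def map_sum W)
    then have "u = (\<Sum>b\<in>B. cinner u (W b) *\<^sub>C W b)"
      using proj_on_basis_vector[OF C(2,3,1)] P by (simp add: bop_apply_sum)
    also have "\<dots> \<in> M" using M W by (simp add: complex_vector.subspace_sum complex_vector.subspace_scale)
    finally show ?thesis using M x by (metis complex_vector.subspace_scale)
  qed
  then show ?thesis by blast
qed

end

section \<open>From rank one operators to all operators\<close>

text \<open>A positive operator \<open>a\<close> dominates the rank one operator
  \<open>outer (a x) (a x) / \<langle>a x, x\<rangle>\<close>, with equality of the two quadratic forms at \<open>x\<close>; this bounds
  \<open>\<psi> a\<close> from below although \<open>\<psi>\<close> is not assumed to be normal. Applying the bound to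
  \<open>K \<plusminus> a\<close> gives equality.\<close>

lemma positive_unital_eq_conjugation:
  fixes \<psi> :: "'h::chilbert_space bop \<Rightarrow> 'h bop"
  assumes lin: "clinear \<psi>" and pos: "positive_map \<psi>" and unital: "\<psi> 1 = 1"
    and V_add: "\<And>x y. V (x + y) = V x + V y" and V_scale: "\<And>c x. V (c *\<^sub>C x) = c *\<^sub>C V x"
    and V_norm: "\<And>x. norm (V x) = norm x" and V_surj: "surj V"
    and outer: "\<And>x. \<psi> (outer x x) = outer (V x) (V x)"
  shows "\<exists>U. unitary_op U \<and> (\<forall>a. \<psi> a = U * a * op_adjoint U)"
proof -
  have \<psi>_add: "\<psi> (a + b) = \<psi> a + \<psi> b" and \<psi>_scale: "\<psi> (c *\<^sub>C a) = c *\<^sub>C \<psi> a" for a b c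
    using lin by (simp_all add: clinear_iff)
  have \<psi>_diff: "\<psi> (a - b) = \<psi> a - \<psi> b" for a b
    unfolding minus_bop_def \<psi>_add \<psi>_scale ..
  define U where "U = Bop V"
  have U: "bop_apply U = V"
    unfolding U_def by (rule bop_apply_Bop[of _ 1]) (simp_all add: V_add V_scale V_norm)
  have "op_adjoint U * U - 1 = 0"
    by (rule quadratic_form_zero) (simp add: cinner_lin cinner_adjoint_left U cinner_self V_norm)
  then have UU: "op_adjoint U * U = 1" by simp
  have UU': "U * op_adjoint U = 1"
  proof (rule bop_eqI)
    fix y
    obtain x where x: "y = V x" using V_surj by blast
    have "bop_apply (op_adjoint U) y = x" using UU unfolding x U[symmetric]
      by (metis bop_apply_one bop_apply_times)
    then show "bop_apply (U * op_adjoint U) y = bop_apply 1 y" by (simp add: U x)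
  qed
  have V_cinner: "cinner (V x) (V y) = cinner x y" for x y
    using UU unfolding U[symmetric] by (metis bop_apply_one bop_apply_times cinner_adjoint_right)
  have lower: "Re (cinner (bop_apply a x) x) \<le> Re (cinner (bop_apply (\<psi> a) (V x)) (V x))"
    if a: "positive_op a" for a x
  proof -
    have \<psi>a: "positive_op (\<psi> a)" using a pos by (simp add: positive_map_def)
    define t where "t = Re (cinner (bop_apply a x) x)"
    have axx: "cinner (bop_apply a x) x = complex_of_real t"
      using a by (simp add: t_def positive_op_def complex_eq_iff)
    have "0 \<le> t" using a by (simp add: t_def positive_op_def)
    show ?thesis
    proof (cases "t = 0")
      case True
      then show ?thesis using \<psi>a by (simp add: t_def positive_op_def)
    next
      case False
      then have t: "t > 0" using \<open>0 \<le> t\<close> by simp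
      define b where "b = complex_of_real (1 / t) *\<^sub>C outer (bop_apply a x) (bop_apply a x)"
      have b_form: "cinner (bop_apply b y) y = complex_of_real ((cmod (cinner y (bop_apply a x)))\<^sup>2 / t)" for y
        unfolding b_def bop_apply_scaleC cinner_scaleC_left cinner_outer_self by simp
      have "positive_op (a - b)"
        unfolding positive_op_def
      proof
        fix y
        have "cmod (cinner y (bop_apply a x)) = cmod (cinner (bop_apply a x) y)"
          by (metis cinner_commute complex_mod_cnj)
        then have "(cmod (cinner y (bop_apply a x)))\<^sup>2 \<le> t * Re (cinner (bop_apply a y) y)"
          using positive_op_Cauchy_Schwarz[OF a, of x y] by (simp add: t_def)
        then have "(cmod (cinner y (bop_apply a x)))\<^sup>2 / t \<le> Re (cinner (bop_apply a y) y)"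
          using t by (simp add: field_simps)
        then show "Im (cinner (bop_apply (a - b) y) y) = 0 \<and> 0 \<le> Re (cinner (bop_apply (a - b) y) y)"
          using a by (simp add: cinner_diff_left b_form positive_op_def)
      qed
      then have "positive_op (\<psi> a - \<psi> b)" using pos by (simp add: positive_map_def flip: \<psi>_diff)
      then have "Re (cinner (bop_apply (\<psi> b) (V x)) (V x)) \<le> Re (cinner (bop_apply (\<psi> a) (V x)) (V x))"
        by (simp add: positive_op_def cinner_diff_left)
      moreover have "cinner (bop_apply (\<psi> b) (V x)) (V x) = complex_of_real t"
      proof -
        have "cinner (bop_apply (\<psi> b) (V x)) (V x)
          = complex_of_real (1 / t) * complex_of_real ((cmod (cinner x (bop_apply a x)))\<^sup>2)"
          unfolding b_def \<psi>_scale outer bop_apply_scaleC cinner_scaleC_left cinner_outer_self V_cinner ..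
        also have "cinner x (bop_apply a x) = complex_of_real t"
          using axx positive_op_symmetric[OF a] by metis
        finally show ?thesis using t by (simp add: power2_eq_square)
      qed
      ultimately show ?thesis by (simp add: t_def)
    qed
  qed
  have real_case: "cinner (bop_apply (\<psi> a) (V x)) (V x) = cinner (bop_apply a x) x"
    if real: "\<And>x. Im (cinner (bop_apply a x) x) = 0" for a x
  proof -
    obtain K where K: "\<And>x. norm (bop_apply a x) \<le> K * norm x" using bop_bound by blast
    define \<kappa> where "\<kappa> = complex_of_real K *\<^sub>C (1 :: 'h bop)"
    have "\<bar>Re (cinner (bop_apply a x) x)\<bar> \<le> K * (norm x)\<^sup>2" for x
    proof -
      have "\<bar>Re (cinner (bop_apply a x) x)\<bar> \<le> norm (bop_apply a x) * norm x"
        using abs_Re_le_cmod cinner_Cauchy_Schwarz order_trans by blast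
      also have "\<dots> \<le> (K * norm x) * norm x" by (intro mult_right_mono K) simp
      finally show ?thesis by (simp add: power2_eq_square mult_ac)
    qed
    then have le: "Re (cinner (bop_apply a x) x) \<le> K * (norm x)\<^sup>2"
      "- Re (cinner (bop_apply a x) x) \<le> K * (norm x)\<^sup>2" for x
      by (metis abs_le_D1, metis abs_le_D2)
    have p1: "positive_op (\<kappa> + a)" and p2: "positive_op (\<kappa> - a)"
      unfolding positive_op_def \<kappa>_def
      using le real by (simp_all add: cinner_lin cinner_self add.commute minus_le_iff)
        (smt (verit) le)
    have "Re (cinner (bop_apply a x) x) \<le> Re (cinner (bop_apply (\<psi> a) (V x)) (V x))"
      using lower[OF p1, of x] unfolding \<psi>_add \<kappa>_def \<psi>_scale unital by (simp add: cinner_lin V_cinner)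
    moreover have "Re (cinner (bop_apply (\<psi> a) (V x)) (V x)) \<le> Re (cinner (bop_apply a x) x)"
      using lower[OF p2, of x] unfolding \<psi>_diff \<kappa>_def \<psi>_scale unital by (simp add: cinner_lin V_cinner)
    moreover have "Im (cinner (bop_apply (\<psi> a) (V x)) (V x)) = 0"
    proof -
      have "positive_op (\<psi> (\<kappa> + a))" using p1 pos by (simp add: positive_map_def)
      then show ?thesis unfolding \<psi>_add \<kappa>_def \<psi>_scale unital
        by (simp add: positive_op_def cinner_lin cinner_self)
    qed
    ultimately show ?thesis using real by (simp add: complex_eq_iff)
  qed
  have general: "cinner (bop_apply (\<psi> a) (V x)) (V x) = cinner (bop_apply a x) x" for a x
  proof -
    have adj: "cinner (bop_apply (op_adjoint a) y) y = cnj (cinner (bop_apply a y) y)" for y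
      by (metis cinner_adjoint_left cinner_commute)
    \<comment> \<open>Twice the real part of \<open>a\<close> and minus twice its imaginary part:
      both forms are real, and 2 a = h - i l.\<close>
    define h l where "h = a + op_adjoint a" and "l = \<i> *\<^sub>C (a - op_adjoint a)"
    have h: "cinner (bop_apply (\<psi> h) (V x)) (V x) = cinner (bop_apply h x) x"
      by (rule real_case) (simp add: h_def cinner_lin adj)
    have l: "cinner (bop_apply (\<psi> l) (V x)) (V x) = cinner (bop_apply l x) x"
      by (rule real_case) (simp add: l_def cinner_lin adj)
    have a: "2 *\<^sub>C a = h - \<i> *\<^sub>C l"
      unfolding h_def l_def
      by (rule bop_eqI, rule cinner_ext) (simp add: cinner_lin algebra_simps)
    have "2 * cinner (bop_apply (\<psi> a) (V x)) (V x) = cinner (bop_apply (\<psi> (2 *\<^sub>C a)) (V x)) (V x)"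
      by (simp add: \<psi>_scale cinner_lin)
    also have "\<dots> = cinner (bop_apply (2 *\<^sub>C a) x) x"
      unfolding a \<psi>_diff \<psi>_scale by (simp add: cinner_lin h l)
    finally show ?thesis by (simp add: cinner_lin)
  qed
  have "\<psi> a = U * a * op_adjoint U" for a
  proof -
    \<comment> \<open>Agreement of the quadratic forms at all vectors is agreement of the operators,
      by polarisation.\<close>
    have "op_adjoint U * \<psi> a * U - a = 0"
      by (rule quadratic_form_zero) (simp add: cinner_lin cinner_adjoint_left U general)
    then have "U * a * op_adjoint U = U * (op_adjoint U * \<psi> a * U) * op_adjoint U" by simp
    also have "\<dots> = (U * op_adjoint U) * \<psi> a * (U * op_adjoint U)" by (simp only: mult.assoc)
    finally show ?thesis by (simp add: UU')
  qed
  then show ?thesis using UU UU' unfolding unitary_op_def by blast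
qed

section \<open>Conjugation and transpose for an orthonormal basis\<close>

lemma orthonormal_basis_total:
  assumes e: "orthonormal_basis e" and x: "\<And>i. cinner x (e i) = 0"
  shows "x = 0"
proof -
  have span: "cinner x y = 0" if "y \<in> cspan (range e)" for y
    using that by (induction rule: complex_vector.span_induct_alt) (auto simp: cinner_lin x)
  have "x \<in> closure (cspan (range e))" using e by (simp add: orthonormal_basis_def)
  then obtain X where X: "\<And>n. X n \<in> cspan (range e)" "X \<longlonglongrightarrow> x"
    unfolding closure_sequential by blast
  \<comment> \<open>Orthogonality to the dense span passes to the limit, so \<open>x\<close> is
    orthogonal to itself.\<close>
  have "(\<lambda>n. cinner x (X n)) \<longlonglongrightarrow> cinner x x" by (intro tendsto_cinner tendsto_const X)
  then have "cinner x x = 0" using span[OF X(1)] by (simp add: LIMSEQ_const_iff)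
  then show ?thesis by (simp add: cinner_eq_zero_iff)
qed

text \<open>The conjugation fixing the basis is defined isometrically on the span and extended by
  completeness.\<close>

lemma ex_conjugation:
  fixes e :: "'i \<Rightarrow> 'h::chilbert_space"
  assumes e: "orthonormal_basis e"
  shows "\<exists>J. (\<forall>x y. J (x + y) = J x + J y) \<and> (\<forall>c x. J (c *\<^sub>C x) = cnj c *\<^sub>C J x) \<and>
    (\<forall>x. J (J x) = x) \<and> (\<forall>x y. cinner (J x) (J y) = cinner y x) \<and> (\<forall>i. J (e i) = e i)"
proof -
  have ee: "cinner (e i) (e j) = (if i = j then 1 else 0)" for i j
    using e by (simp add: orthonormal_basis_def)
  \<comment> \<open>\<open>R x y\<close> says that the Fourier coefficients of \<open>y\<close> are
    the conjugates of those of \<open>x\<close>. They determine \<open>y\<close>, so identities for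
    \<open>J\<close> reduce to coefficients.\<close>
  define R where "R x y \<longleftrightarrow> (\<forall>i. cinner y (e i) = cnj (cinner x (e i)))" for x y
  have R_unique: "y = y'" if "R x y" "R x y'" for x y y'
    using orthonormal_basis_total[OF e, of "y - y'"] that by (simp add: R_def cinner_lin)
  have on_span: "\<exists>y. R x y \<and> norm y = norm x" if "x \<in> cspan (range e)" for x
  proof -
    obtain t r where t: "finite t" "t \<subseteq> range e" and x: "x = (\<Sum>a\<in>t. r a *\<^sub>C a)"
      using \<open>x \<in> cspan (range e)\<close> unfolding complex_vector.span_explicit by blast
    define y where "y = (\<Sum>a\<in>t. cnj (r a) *\<^sub>C a)"
    have real: "cnj (cinner a b) = cinner a b" if "a \<in> t" "b \<in> t" for a b
    proof -
      have "a \<in> range e" "b \<in> range e" using t that by auto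
      then show ?thesis using ee by auto
    qed
    have "cinner y y = cnj (cinner x x)"
      unfolding x y_def cinner_sum_left cinner_sum_right cnj_sum
      by (intro sum.cong refl) (use t real in \<open>auto simp: cinner_lin\<close>)
    then have "complex_of_real ((norm y)\<^sup>2) = complex_of_real ((norm x)\<^sup>2)"
      unfolding cinner_self by simp
    then have "norm y = norm x" by (simp only: of_real_eq_iff) simp
    moreover have "R x y"
      unfolding R_def x y_def cinner_sum_left cnj_sum
    proof (intro allI sum.cong refl)
      fix i a assume "a \<in> t"
      then obtain j where "a = e j" using t by blast
      then show "cinner (cnj (r a) *\<^sub>C a) (e i) = cnj (cinner (r a *\<^sub>C a) (e i))"
        by (simp add: cinner_lin ee)
    qed
    ultimately show ?thesis by blast
  qed
  have "\<exists>y. R x y \<and> norm y = norm x" for x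
  proof -
    have "x \<in> closure (cspan (range e))" using e by (simp add: orthonormal_basis_def)
    then obtain X where X: "\<And>n. X n \<in> cspan (range e)" "X \<longlonglongrightarrow> x"
      unfolding closure_sequential by blast
    obtain Y where Y: "\<And>n. R (X n) (Y n)" "\<And>n. norm (Y n) = norm (X n)"
      using on_span[OF X(1)] by metis
    \<comment> \<open>\<open>R\<close> is compatible with differences, so \<open>on_span\<close>
      applied to X m - X n transfers the Cauchy property to \<open>Y\<close>.\<close>
    have "norm (Y m - Y n) = norm (X m - X n)" for m n
    proof -
      have "X m - X n \<in> cspan (range e)" by (intro complex_vector.span_diff X)
      then obtain y where y: "R (X m - X n) y" "norm y = norm (X m - X n)" using on_span by blast
      moreover have "R (X m - X n) (Y m - Y n)"
        using Y(1)[of m] Y(1)[of n] by (simp add: R_def cinner_lin)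
      ultimately show ?thesis using R_unique by blast
    qed
    moreover have "Cauchy X" using X(2) by (rule LIMSEQ_imp_Cauchy)
    ultimately have "Cauchy Y" by (simp add: Cauchy_def dist_norm)
    then obtain y where y: "Y \<longlonglongrightarrow> y" using Cauchy_convergent convergent_def by blast
    have "cinner y (e i) = cnj (cinner x (e i))" for i
    proof (rule LIMSEQ_unique)
      show "(\<lambda>n. cinner (Y n) (e i)) \<longlonglongrightarrow> cinner y (e i)"
        by (intro tendsto_cinner tendsto_const y)
      have "(\<lambda>n. cnj (cinner (X n) (e i))) \<longlonglongrightarrow> cnj (cinner x (e i))"
        by (intro tendsto_cnj tendsto_cinner tendsto_const X)
      then show "(\<lambda>n. cinner (Y n) (e i)) \<longlonglongrightarrow> cnj (cinner x (e i))"
        using Y(1) by (simp add: R_def)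
    qed
    moreover have "norm y = norm x"
      using LIMSEQ_unique[OF tendsto_norm[OF y]] tendsto_norm[OF X(2)] Y(2) by simp
    ultimately show ?thesis unfolding R_def by blast
  qed
  then obtain J where J: "\<And>x. R x (J x)" "\<And>x. norm (J x) = norm x" by metis
  have J_eq: "J x = y" if "R x y" for x y using R_unique[OF J(1) that] .
  have J_add: "J (x + y) = J x + J y" for x y
    by (rule J_eq) (use J(1)[of x] J(1)[of y] in \<open>simp add: R_def cinner_lin\<close>)
  have J_scale: "J (c *\<^sub>C x) = cnj c *\<^sub>C J x" for c x
    by (rule J_eq) (use J(1)[of x] in \<open>simp add: R_def cinner_lin\<close>)
  have J_J: "J (J x) = x" for x
    by (rule J_eq) (use J(1)[of x] in \<open>simp add: R_def\<close>)
  have J_e: "J (e i) = e i" for i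
    by (rule J_eq) (simp add: R_def ee)
  \<comment> \<open>An additive norm-preserving map preserves real parts of inner products;
    antilinearity then reverses the imaginary parts.\<close>
  have J_Re: "Re (cinner (J x) (J y)) = Re (cinner x y)" for x y
    using norm_add_sq[of "J x" "J y"] norm_add_sq[of x y] by (simp add: J(2) flip: J_add)
  have "cinner (J x) (J y) = cinner y x" for x y
  proof -
    have "Im (cinner (J x) (J y)) = - Im (cinner x y)"
      using J_Re[of x "\<i> *\<^sub>C y"] by (simp add: J_scale cinner_lin)
    then have "cinner (J x) (J y) = cnj (cinner x y)" using J_Re by (simp add: complex_eq_iff)
    then show ?thesis by (metis cinner_commute)
  qed
  with J_add J_scale J_J J_e show ?thesis by blast
qed

text \<open>Resolves the definite description in \<open>op_transpose\<close>: J a* J has the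
  required matrix entries, and these determine a bounded operator.\<close>

lemma cinner_op_transpose:
  fixes e :: "'i \<Rightarrow> 'h::chilbert_space"
  assumes e: "orthonormal_basis e"
    and J_add: "\<And>x y. J (x + y) = J x + J y" and J_scale: "\<And>c x. J (c *\<^sub>C x) = cnj c *\<^sub>C J x"
    and J_J: "\<And>x. J (J x) = x" and J_cinner: "\<And>x y. cinner (J x) (J y) = cinner y x"
    and J_e: "\<And>i. J (e i) = e i"
  shows "cinner (bop_apply (op_transpose e a) x) y = cinner (bop_apply a (J y)) (J x)"
proof -
  have J_norm: "norm (J x) = norm x" for x
    by (simp add: norm_eq_sqrt_cinner J_cinner)
  define b where "b = Bop (\<lambda>x. J (bop_apply (op_adjoint a) (J x)))"
  obtain K where K: "\<And>x. norm (bop_apply (op_adjoint a) x) \<le> K * norm x" using bop_bound by blast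
  have b: "bop_apply b = (\<lambda>x. J (bop_apply (op_adjoint a) (J x)))"
    unfolding b_def
    by (rule bop_apply_Bop[of _ K]) (use K[of "J x" for x] in \<open>simp_all add: J_norm J_add J_scale bop_lin\<close>)
  have b_form: "cinner (bop_apply b x) y = cinner (bop_apply a (J y)) (J x)" for x y
  proof -
    have "cinner (bop_apply b x) y = cinner (J (bop_apply (op_adjoint a) (J x))) (J (J y))"
      by (simp add: b J_J)
    also have "\<dots> = cinner (bop_apply a (J y)) (J x)"
      unfolding J_cinner by (rule cinner_adjoint_right)
    finally show ?thesis .
  qed
  have "op_transpose e a = b"
    unfolding op_transpose_def
  proof (rule the_equality)
    show "\<forall>i j. cinner (bop_apply b (e j)) (e i) = cinner (bop_apply a (e i)) (e j)"
      by (simp add: b_form J_e)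
    fix c assume "\<forall>i j. cinner (bop_apply c (e j)) (e i) = cinner (bop_apply a (e i)) (e j)"
    then have "cinner (bop_apply (c - b) (e j)) (e i) = 0" for i j
      by (simp add: cinner_diff_left b_form J_e)
    then have 0: "bop_apply (c - b) (e j) = 0" for j by (rule orthonormal_basis_total[OF e])
    \<comment> \<open>Since c - b vanishes on the basis, all Fourier coefficients of its adjoint's
      values vanish.\<close>
    have "bop_apply (op_adjoint (c - b)) y = 0" for y
    proof (rule orthonormal_basis_total[OF e])
      show "cinner (bop_apply (op_adjoint (c - b)) y) (e j) = 0" for j
        unfolding cinner_adjoint_left 0 by simp
    qed
    then have "cinner (bop_apply (c - b) x) y = 0" for x y
      by (metis cinner_adjoint_right cinner_zero_right)
    then have "c - b = 0" by (intro quadratic_form_zero)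
    then show "c = b" by simp
  qed
  then show ?thesis by (simp add: b_form)
qed

section \<open>Construction of the unitary in the two cases\<close>

theorem theorem2:
  fixes e :: "'i \<Rightarrow> 'h::chilbert_space"
    and k :: nat
    and \<phi> :: "'h bop \<Rightarrow> 'h bop"
  assumes "1 \<le> k" and "enat k < ecdim (UNIV :: 'h set)"
    and "orthonormal_basis e"
    and "clinear \<phi>" and "positive_map \<phi>" and "\<phi> 1 = 1"
    and "\<phi> ` rank_projections k = rank_projections k"
  shows "\<exists>U. unitary_op U \<and>
           ((\<forall>a. \<phi> a = U * a * op_adjoint U) \<or>
            (\<forall>a. \<phi> a = U * op_transpose e a * op_adjoint U))"
proof -
  interpret rank_projection_preserver k \<phi>
    by unfold_locales (use assms in auto)
  obtain V where V: "\<And>u. \<phi> (outer u u) = outer (V u) (V u)"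
    and V_add: "\<And>x y. V (x + y) = V x + V y"
    and V_scale: "(\<forall>c x. V (c *\<^sub>C x) = c *\<^sub>C V x) \<or> (\<forall>c x. V (c *\<^sub>C x) = cnj c *\<^sub>C V x)"
    using linear_or_antilinear by blast
  have V_norm: "norm (V x) = norm x" for x
    using map_outer_self[of x] V outer_self_eq_norm by metis
  have "complex_vector.subspace (range V)"
    unfolding complex_vector.subspace_def
  proof (intro conjI ballI allI)
    show "0 \<in> range V" using V_norm[of 0] by (auto intro: range_eqI[of _ _ 0])
    show "x + y \<in> range V" if "x \<in> range V" "y \<in> range V" for x y
      using that by (auto simp flip: V_add)
    show "c *\<^sub>C x \<in> range V" if x_in: "x \<in> range V" for c x
    proof -
      obtain u where x: "x = V u" using x_in by blast
      \<comment> \<open>The range is a complex subspace in both cases; in the antilinear one the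
        scalar is conjugated in the argument.\<close>
      have "c *\<^sub>C x = V (c *\<^sub>C u) \<or> c *\<^sub>C x = V (cnj c *\<^sub>C u)"
        using V_scale by (auto simp: x)
      then show ?thesis by blast
    qed
  qed
  then have V_surj: "surj V"
    by (rule representing_map_surj[rotated]) (use assms(7) V in auto)
  from V_scale show ?thesis
  proof
    assume "\<forall>c x. V (c *\<^sub>C x) = c *\<^sub>C V x"
    then have "\<exists>U. unitary_op U \<and> (\<forall>a. \<phi> a = U * a * op_adjoint U)"
      by (intro positive_unital_eq_conjugation[of \<phi> V] assms V V_add V_norm V_surj) blast
    then show ?thesis by blast
  next
    assume V_antilinear: "\<forall>c x. V (c *\<^sub>C x) = cnj c *\<^sub>C V x"
    obtain J :: "'h \<Rightarrow> 'h" where J_add: "\<And>x y. J (x + y) = J x + J y"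
      and J_scale: "\<And>c x. J (c *\<^sub>C x) = cnj c *\<^sub>C J x" and J_J: "\<And>x. J (J x) = x"
      and J_cinner: "\<And>x y. cinner (J x) (J y) = cinner y x" and J_e: "\<And>i. J (e i) = e i"
      using ex_conjugation[OF assms(3)] by metis
    have t: "cinner (bop_apply (op_transpose e a) x) y = cinner (bop_apply a (J y)) (J x)" for a x y
      by (rule cinner_op_transpose[OF assms(3) J_add J_scale J_J J_cinner J_e])
    have eqI: "a = b" if "\<And>x y. cinner (bop_apply a x) y = cinner (bop_apply b x) y" for a b :: "'h bop"
      using that by (intro bop_eqI cinner_ext)
    have t_add: "op_transpose e (a + b) = op_transpose e a + op_transpose e b" for a b
      by (rule eqI) (simp add: t cinner_lin)
    have t_scale: "op_transpose e (c *\<^sub>C a) = c *\<^sub>C op_transpose e a" for a c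
      by (rule eqI) (simp add: t cinner_lin)
    have t_one: "op_transpose e 1 = 1"
      by (rule eqI) (simp add: t J_cinner)
    have t_t: "op_transpose e (op_transpose e a) = a" for a
      by (rule eqI) (simp add: t J_J)
    have t_outer: "op_transpose e (outer x x) = outer (J x) (J x)" for x
    proof (rule eqI)
      fix v w
      have "cinner v (J x) = cinner x (J v)" "cinner (J x) w = cinner (J w) x"
        using J_cinner[of "J v" x] J_cinner[of x "J w"] by (simp_all add: J_J)
      then show "cinner (bop_apply (op_transpose e (outer x x)) v) w
          = cinner (bop_apply (outer (J x) (J x)) v) w"
        by (simp add: t cinner_lin mult.commute)
    qed
    \<comment> \<open>Precomposing with the transpose replaces the antilinear \<open>V\<close> by
      the linear \<open>V \<circ> J\<close>; the transpose is an involution, so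
      \<open>\<phi>\<close> is recovered from \<open>\<psi>\<close>.\<close>
    define \<psi> where "\<psi> a = \<phi> (op_transpose e a)" for a
    have "\<exists>U. unitary_op U \<and> (\<forall>a. \<psi> a = U * a * op_adjoint U)"
    proof (rule positive_unital_eq_conjugation[of \<psi> "V \<circ> J"])
      show "clinear \<psi>" by (simp add: clinear_iff \<psi>_def t_add t_scale map_add map_scaleC)
      show "positive_map \<psi>"
        unfolding positive_map_def \<psi>_def
        \<comment> \<open>The form of the transpose at x is the form of the operator at
          \<open>J x\<close>, so transposition preserves positivity.\<close>
        by (intro allI impI map_positive) (simp add: positive_op_def t)
      show "\<psi> 1 = 1" by (simp add: \<psi>_def t_one unital)
      show "norm ((V \<circ> J) x) = norm x" for x
        by (simp add: V_norm norm_eq_sqrt_cinner[of "J x"] norm_eq_sqrt_cinner[of x] J_cinner)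
      show "surj (V \<circ> J)" using V_surj surjI[of J J, OF J_J] by (rule comp_surj[rotated])
      show "\<psi> (outer x x) = outer ((V \<circ> J) x) ((V \<circ> J) x)" for x
        by (simp add: \<psi>_def t_outer V)
    qed (simp_all add: V_add J_add J_scale V_antilinear)
    then obtain U where "unitary_op U" "\<And>a. \<psi> a = U * a * op_adjoint U" by blast
    moreover have "\<phi> a = \<psi> (op_transpose e a)" for a by (simp add: \<psi>_def t_t)
    ultimately show ?thesis by metis
  qed
qed

end
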